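(* Let $\omega\in\mathbb{T}^1$ be irrational, let $\tau,\alpha,\beta\in\mathbb{R}$, and let $f:\mathbb{T}^1\times\mathbb{T}^1\to\mathbb{T}^1\times\mathbb{T}^1$ be the quasiperiodically forced Arnold circle map $$f(\theta,\varphi)=\left(\theta+\omega,\ \varphi+\tau+\frac{\alpha}{2\pi}\sin(2\pi\varphi)+\beta\sin(2\pi\theta)\bmod 1\right),$$ with lift $F:\mathbb{T}^1\times\mathbb{R}\to\mathbb{T}^1\times\mathbb{R}$, $F(\theta,x)=(\theta+\omega,F_\theta(x))$, $F_\theta(x)=x+\tau+\frac{\alpha}{2\pi}\sin(2\pi x)+\beta\sin(2\pi\theta)$. (a) If $\alpha>1$ and $|\beta|\ge\frac32$, then for every $\rho\in\rho_{\mathrm{fib}}(F)$ there exists a strangely dispersed minimal set $M_\rho\subseteq\mathbb{T}^1\times\mathbb{T}^1$ of $f$ such that (i) $\frac1n\left(F^n_\theta(x)-x\right)$ converges to $\rho$ as $n\to\infty$, uniformly over $(\theta,x)\in\pi^{-1}(M_\rho)$, and (ii) $h_{\mathrm{top}}(f|_{M_\rho})=0$. (b) If $|\alpha|\ge\frac52\pi$, then $\rho_{\mathrm{fib}}(F)$ has length at least $1$; in particular, its interior is non-empty.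
   Context: $\mathbb{T}^1=\mathbb{R}/\mathbb{Z}$ is the circle, $\pi:\mathbb{T}^1\times\mathbb{R}\to\mathbb{T}^1\times\mathbb{T}^1$ is the natural projection, and $\pi_1$ is the projection of $\mathbb{T}^1\times\mathbb{T}^1$ to its first coordinate. Write $r(\theta)=\theta+\omega$ and $F^n_\theta=F_{r^{n-1}(\theta)}\circ\cdots\circ F_{r(\theta)}\circ F_\theta$. The fibred rotation interval of $F$, which is always a closed interval (possibly a single point), is $$\rho_{\mathrm{fib}}(F)=\left\{\limsup_{n\to\infty}\tfrac1n\left(F^n_\theta(x)-x\right)\ \middle|\ (\theta,x)\in\mathbb{T}^1\times\mathbb{R}\right\}.$$ A (non-empty) closed $f$-invariant set $M$ is minimal if it contains no proper non-empty closed $f$-invariant subset. A compact set $M\subseteq\mathbb{T}^1\times\mathbb{T}^1$ is a strangely dispersed minimal set of $f$ if: (1) $M$ is a minimal set of $f$; (2) every connected component $C$ of $M$ is contained in a single fibre, i.e. $\pi_1(C)$ is a singleton; (3) for every point $z\in M$ and every open neighbourhood $U$ of $z$, the set $\pi_1(U\cap M)$ contains a non-empty open interval. $h_{\mathrm{top}}$ denotes topological entropy. *)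

theory Defs
  imports "HOL-Analysis.Analysis"
begin

section \<open>The circle as the metric group of reals modulo integers\<close>

definition int_equiv :: "real \<Rightarrow> real \<Rightarrow> bool" where
  "int_equiv x y \<longleftrightarrow> x - y \<in> \<int>"

lemma equivp_int_equiv: "equivp int_equiv"
proof (rule equivpI)
  show "reflp int_equiv" by (auto simp: reflp_def int_equiv_def)
  show "symp int_equiv"
    by (metis Ints_minus int_equiv_def minus_diff_eq sympI)
  show "transp int_equiv"
  proof (rule transpI)
    fix x y z assume "int_equiv x y" "int_equiv y z"
    then have "(x - y) + (y - z) \<in> \<int>"
      unfolding int_equiv_def by (rule Ints_add)
    then show "int_equiv x z" by (simp add: int_equiv_def)
  qed
qed

quotient_type circle = real / int_equiv
  by (rule equivp_int_equiv)

lift_definition circle_of :: "real \<Rightarrow> circle" is "\<lambda>x. x" .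

lemma circle_of_eq_iff: "circle_of x = circle_of y \<longleftrightarrow> x - y \<in> \<int>"
  by transfer (simp add: int_equiv_def)

lemma circle_of_surj: "\<exists>x. c = circle_of x"
  by transfer (use equivp_int_equiv in \<open>auto dest: equivp_reflp\<close>)

instantiation circle :: ab_group_add
begin

lift_definition zero_circle :: circle is "0" .

lift_definition plus_circle :: "circle \<Rightarrow> circle \<Rightarrow> circle" is "(+)"
proof -
  fix a b c d :: real assume "int_equiv a b" "int_equiv c d"
  then have "(a - b) + (c - d) \<in> \<int>" unfolding int_equiv_def by (rule Ints_add)
  then show "int_equiv (a + c) (b + d)" by (simp add: int_equiv_def algebra_simps)
qed

lift_definition uminus_circle :: "circle \<Rightarrow> circle" is "uminus"
proof -
  fix a b :: real assume "int_equiv a b"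
  then have "- (a - b) \<in> \<int>" unfolding int_equiv_def by (rule Ints_minus)
  then show "int_equiv (- a) (- b)" by (simp add: int_equiv_def algebra_simps)
qed

definition minus_circle :: "circle \<Rightarrow> circle \<Rightarrow> circle" where
  "minus_circle a b = a + (- b)"

instance
proof
  fix a b c :: circle
  show "a + b + c = a + (b + c)"
    by transfer (simp add: int_equiv_def algebra_simps)
  show "a + b = b + a"
    by transfer (simp add: int_equiv_def algebra_simps)
  show "0 + a = a"
    by transfer (simp add: int_equiv_def)
  show "- a + a = 0"
    by transfer (simp add: int_equiv_def)
  show "a - b = a + - b"
    by (rule minus_circle_def)
qed

end

lemma circle_of_add: "circle_of (x + y) = circle_of x + circle_of y"
  by transfer (simp add: int_equiv_def)

lemma circle_of_diff: "circle_of (x - y) = circle_of x - circle_of y"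
  unfolding minus_circle_def by transfer (simp add: int_equiv_def)

definition int_dist :: "real \<Rightarrow> real" where
  "int_dist x = \<bar>x - of_int (round x)\<bar>"

lemma int_dist_le: "int_dist x \<le> \<bar>x - of_int k\<bar>"
  unfolding int_dist_def by (rule round_diff_minimal)

lemma int_dist_cong:
  assumes "x - y \<in> \<int>"
  shows "int_dist x = int_dist y"
proof -
  have le: "int_dist a \<le> int_dist b" if ab: "a - b \<in> \<int>" for a b
  proof -
    obtain k where k: "a - b = of_int k" using ab by (rule Ints_cases)
    have "int_dist a \<le> \<bar>a - of_int (round b + k)\<bar>" by (rule int_dist_le)
    also have "a - of_int (round b + k) = b - of_int (round b)" using k by simp
    finally show ?thesis by (simp add: int_dist_def)
  qed
  have "y - x \<in> \<int>" using Ints_minus[OF assms] by simp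
  then show ?thesis using le assms by (meson order_antisym)
qed

instantiation circle :: metric_space
begin

lift_definition dist_circle :: "circle \<Rightarrow> circle \<Rightarrow> real" is "\<lambda>x y. int_dist (x - y)"
proof -
  fix a b c d :: real assume "int_equiv a b" "int_equiv c d"
  then have "(a - b) - (c - d) \<in> \<int>" unfolding int_equiv_def by (rule Ints_diff)
  then show "int_dist (a - c) = int_dist (b - d)"
    by (intro int_dist_cong) (simp add: algebra_simps)
qed

definition uniformity_circle :: "(circle \<times> circle) filter" where
  "uniformity_circle = (INF e\<in>{0 <..}. principal {(x, y). dist x y < e})"

definition open_circle :: "circle set \<Rightarrow> bool" where
  "open_circle U \<longleftrightarrow> (\<forall>x\<in>U. \<forall>\<^sub>F (x', y) in uniformity. x' = x \<longrightarrow> y \<in> U)"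

instance
proof
  show "uniformity = (INF e\<in>{0 <..}. principal {(x::circle, y). dist x y < e})"
    by (rule uniformity_circle_def)
  show "open U \<longleftrightarrow> (\<forall>x\<in>U. \<forall>\<^sub>F (x', y) in uniformity. x' = x \<longrightarrow> y \<in> U)" for U :: "circle set"
    by (rule open_circle_def)
  show "dist x y = 0 \<longleftrightarrow> x = y" for x y :: circle
  proof transfer
    fix x y :: real
    have "x - y \<in> \<int>" if "int_dist (x - y) = 0"
    proof -
      have "x - y = of_int (round (x - y))" using that by (simp add: int_dist_def)
      then show ?thesis by (metis Ints_of_int)
    qed
    moreover have "int_dist (x - y) = 0" if "x - y \<in> \<int>"
      using int_dist_cong[of "x - y" 0] that by (simp add: int_dist_def)
    ultimately show "int_dist (x - y) = 0 \<longleftrightarrow> int_equiv x y"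
      by (auto simp: int_equiv_def)
  qed
  show "dist x y \<le> dist x z + dist y z" for x y z :: circle
  proof transfer
    fix x y z :: real
    have "int_dist (x - y) \<le> \<bar>(x - y) - of_int (round (x - z) - round (y - z))\<bar>"
      by (rule int_dist_le)
    also have "\<dots> \<le> int_dist (x - z) + int_dist (y - z)"
      unfolding int_dist_def by simp
    finally show "int_dist (x - y) \<le> int_dist (x - z) + int_dist (y - z)" .
  qed
qed

end

lemma dist_circle_of: "dist (circle_of x) (circle_of y) = \<bar>x - y - of_int (round (x - y))\<bar>"
  by transfer (simp add: int_dist_def)

lemma dist_circle_of_le: "dist (circle_of x) (circle_of y) \<le> dist x y"
  using int_dist_le[of "x - y" 0] by transfer (simp add: dist_real_def)

lemma continuous_on_circle_of: "continuous_on S circle_of"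
  unfolding continuous_on_iff using dist_circle_of_le by (meson order_le_less_trans)

lemma compact_UNIV_circle: "compact (UNIV :: circle set)"
proof -
  have "c \<in> circle_of ` {0..1}" for c
  proof -
    obtain x where x: "c = circle_of x" using circle_of_surj by blast
    have "c = circle_of (frac x)"
      unfolding x circle_of_eq_iff frac_def by simp
    moreover have "frac x \<in> {0..1}"
      using frac_ge_0[of x] frac_lt_1[of x] by simp
    ultimately show ?thesis by blast
  qed
  then have "UNIV = circle_of ` {0..1}" by auto
  then show ?thesis
    using compact_continuous_image[OF continuous_on_circle_of compact_Icc, of 0 1] by simp
qed

text \<open>The metric topology is the quotient topology.\<close>

lemma open_circle_iff: "open U \<longleftrightarrow> open (circle_of -` U)"
proof
  show "open U \<Longrightarrow> open (circle_of -` U)"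
    by (rule open_vimage[OF _ continuous_on_circle_of])
next
  assume op: "open (circle_of -` U)"
  show "open U"
    unfolding open_dist
  proof
    fix c assume "c \<in> U"
    obtain x where x: "c = circle_of x" using circle_of_surj by blast
    with op \<open>c \<in> U\<close> obtain e where e: "e > 0" "\<And>y. dist y x < e \<Longrightarrow> circle_of y \<in> U"
      unfolding open_dist by auto
    have "d \<in> U" if "dist d c < e" for d
    proof -
      obtain y where y: "d = circle_of y" using circle_of_surj by blast
      let ?y = "y - of_int (round (y - x))"
      have "dist ?y x = dist d c"
        unfolding x y dist_circle_of dist_real_def by (simp add: algebra_simps)
      then have "circle_of ?y \<in> U" using e that by simp
      moreover have "circle_of ?y = d" unfolding y circle_of_eq_iff by simp
      ultimately show ?thesis by simp
    qed
    with \<open>e > 0\<close> show "\<exists>e>0. \<forall>d. dist d c < e \<longrightarrow> d \<in> U" by blast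
  qed
qed

definition circle_open_interval :: "circle set \<Rightarrow> bool" where
  "circle_open_interval I \<longleftrightarrow> (\<exists>a b. a < b \<and> I = circle_of ` {a<..<b})"

lift_definition sin2pi :: "circle \<Rightarrow> real" is "\<lambda>x. sin (2 * pi * x)"
proof -
  fix a b :: real assume "int_equiv a b"
  then obtain k where "a - b = of_int k" unfolding int_equiv_def by (rule Ints_cases)
  then have "a = b + of_int k" by simp
  then have "2 * pi * a = 2 * pi * b + 2 * pi * of_int k" by (simp only: distrib_left)
  then show "sin (2 * pi * a) = sin (2 * pi * b)"
    by (simp add: sin_add sin_int_2pin cos_int_2pin)
qed


section \<open>Topological dynamics\<close>

definition minimal_set :: "('a::topological_space \<Rightarrow> 'a) \<Rightarrow> 'a set \<Rightarrow> bool" where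
  "minimal_set f M \<longleftrightarrow> M \<noteq> {} \<and> closed M \<and> f ` M \<subseteq> M \<and>
     \<not> (\<exists>K. K \<subset> M \<and> K \<noteq> {} \<and> closed K \<and> f ` K \<subseteq> K)"

definition strangely_dispersed_minimal_set ::
    "(circle \<times> circle \<Rightarrow> circle \<times> circle) \<Rightarrow> (circle \<times> circle) set \<Rightarrow> bool" where
  "strangely_dispersed_minimal_set f M \<longleftrightarrow>
     compact M \<and>
     minimal_set f M \<and>
     (\<forall>C\<in>components M. \<exists>\<theta>. fst ` C = {\<theta>}) \<and>
     (\<forall>z\<in>M. \<forall>U. open U \<and> z \<in> U \<longrightarrow>
        (\<exists>I. circle_open_interval I \<and> I \<subseteq> fst ` (U \<inter> M)))"

definition dyn_separated :: "('a::metric_space \<Rightarrow> 'a) \<Rightarrow> nat \<Rightarrow> real \<Rightarrow> 'a set \<Rightarrow> bool" where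
  "dyn_separated f n \<epsilon> E \<longleftrightarrow>
     (\<forall>x\<in>E. \<forall>y\<in>E. x \<noteq> y \<longrightarrow> (\<exists>k<n. \<epsilon> < dist ((f ^^ k) x) ((f ^^ k) y)))"

text \<open>Bowen's definition of the entropy of the restriction of \<open>f\<close> to a compact \<open>f\<close>-invariant
  set \<open>M\<close>. The supremum over the logarithms of the cardinalities is taken in the extended reals,
  so that no boundedness of the cardinalities is presupposed. The supremum over all \<open>\<epsilon> > 0\<close> is the
  limit for \<open>\<epsilon> \<rightarrow> 0\<close>, as the expression is antitone in \<open>\<epsilon>\<close>.\<close>

definition htop_on :: "('a::metric_space \<Rightarrow> 'a) \<Rightarrow> 'a set \<Rightarrow> ereal" where
  "htop_on f M =
     (SUP \<epsilon>\<in>{0<..}. limsup (\<lambda>n.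
        SUP E\<in>{E. finite E \<and> E \<subseteq> M \<and> dyn_separated f n \<epsilon> E}.
          ereal (ln (real (card E)) / real n)))"


section \<open>Quasiperiodically forced maps\<close>

text \<open>\<open>fib_iterate \<omega> G n \<theta>\<close> is the composition of the fibre maps \<open>G \<theta>\<close>, \<open>G (\<theta> + \<omega>)\<close>, \dots{} of
  the skew product \<open>(\<theta>, x) \<mapsto> (\<theta> + \<omega>, G \<theta> x)\<close> along the first \<open>n\<close> points of the orbit of \<open>\<theta>\<close>.\<close>

primrec fib_iterate ::
    "circle \<Rightarrow> (circle \<Rightarrow> real \<Rightarrow> real) \<Rightarrow> nat \<Rightarrow> circle \<Rightarrow> real \<Rightarrow> real" where
  "fib_iterate \<omega> G 0 \<theta> = id"
| "fib_iterate \<omega> G (Suc n) \<theta> = G (((\<lambda>\<theta>. \<theta> + \<omega>) ^^ n) \<theta>) \<circ> fib_iterate \<omega> G n \<theta>"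

definition fib_rotation_set :: "circle \<Rightarrow> (circle \<Rightarrow> real \<Rightarrow> real) \<Rightarrow> real set" where
  "fib_rotation_set \<omega> G =
     {\<rho>. \<exists>\<theta> x. ereal \<rho> = limsup (\<lambda>n. ereal ((fib_iterate \<omega> G n \<theta> x - x) / real n))}"

definition torus_proj :: "circle \<times> real \<Rightarrow> circle \<times> circle" where
  "torus_proj = (\<lambda>(\<theta>, x). (\<theta>, circle_of x))"

definition arnold_map ::
    "circle \<Rightarrow> real \<Rightarrow> real \<Rightarrow> real \<Rightarrow> circle \<times> circle \<Rightarrow> circle \<times> circle" where
  "arnold_map \<omega> \<tau> \<alpha> \<beta> = (\<lambda>(\<theta>, \<phi>).
     (\<theta> + \<omega>, \<phi> + circle_of (\<tau> + \<alpha> / (2 * pi) * sin2pi \<phi> + \<beta> * sin2pi \<theta>)))"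

definition arnold_fibre :: "real \<Rightarrow> real \<Rightarrow> real \<Rightarrow> circle \<Rightarrow> real \<Rightarrow> real" where
  "arnold_fibre \<tau> \<alpha> \<beta> \<theta> x = x + \<tau> + \<alpha> / (2 * pi) * sin (2 * pi * x) + \<beta> * sin2pi \<theta>"

definition arnold_lift ::
    "circle \<Rightarrow> real \<Rightarrow> real \<Rightarrow> real \<Rightarrow> circle \<times> real \<Rightarrow> circle \<times> real" where
  "arnold_lift \<omega> \<tau> \<alpha> \<beta> = (\<lambda>(\<theta>, x). (\<theta> + \<omega>, arnold_fibre \<tau> \<alpha> \<beta> \<theta> x))"

lemma arnold_lift_semiconj:
  "torus_proj (arnold_lift \<omega> \<tau> \<alpha> \<beta> p) = arnold_map \<omega> \<tau> \<alpha> \<beta> (torus_proj p)"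
proof -
  obtain \<theta> x where p: "p = (\<theta>, x)" by (cases p)
  have "sin2pi (circle_of x) = sin (2 * pi * x)" by transfer simp
  then show ?thesis
    by (simp add: p torus_proj_def arnold_lift_def arnold_map_def arnold_fibre_def circle_of_add add.assoc)
qed

lemma arnold_lift_funpow:
  "(arnold_lift \<omega> \<tau> \<alpha> \<beta> ^^ n) (\<theta>, x) =
     (((\<lambda>\<theta>. \<theta> + \<omega>) ^^ n) \<theta>, fib_iterate \<omega> (arnold_fibre \<tau> \<alpha> \<beta>) n \<theta> x)"
  by (induction n) (simp_all add: arnold_lift_def)

end

theory Submission
  imports Defs
begin

text \<open>The fibre maps have the form \<open>h x + \<beta> sin (2\<pi>\<theta>)\<close> with a fixed degree one map \<open>h\<close>. For \<open>\<mu> \<ge> 0\<close> let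
  \<open>H \<mu>\<close> be the upper monotone envelope of \<open>min h (\<ell> + \<mu>)\<close>, where \<open>\<ell>\<close> is the lower monotone envelope of \<open>h\<close>.
  These monotone maps interpolate between the two envelopes of \<open>h\<close>, and each value of \<open>H \<mu>\<close> is attained at a
  point where \<open>H \<mu> = h\<close>. A monotone cocycle over an irrational rotation has a uniform rotation number \<open>r\<close>,
  which depends continuously on \<open>\<mu>\<close>, and by the surjectivity just mentioned there are points whose
  whole orbits remain in the region \<open>H \<mu> = h\<close>. On the minimal sets in this region \<open>f\<close> agrees with a monotone
  extension, so that the rotation number is \<open>r \<mu>\<close> and the entropy vanishes; this yields all rotation
  numbers between those of the two envelopes. For \<open>\<bar>\<alpha>\<bar> \<ge> 5\<pi>/2\<close> the envelopes differ by at least one.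

  By minimality, a component of such a minimal set that is not contained in a fibre forces a component
  that projects onto the whole circle. If \<open>\<alpha> > 1\<close>, then \<open>H \<mu> \<noteq> h\<close> at some point, so that the
  minimal set misses a horizontal circle; but the forcing term spreads the image of a full component
  over more than one turn, which would have to cross that circle.
  A finite Baire argument provides the intervals in the projections.\<close>

section \<open>Truncations of degree one maps\<close>

text \<open>Lifts of degree one circle maps. An explicit constant is carried along because envelopes
  and truncations inherit it unchanged.\<close>

definition degree_one_lipschitz :: "real \<Rightarrow> (real \<Rightarrow> real) \<Rightarrow> bool" where
  "degree_one_lipschitz L g \<longleftrightarrow> (\<forall>x. g (x + 1) = g x + 1) \<and> (\<forall>x y. \<bar>g x - g y\<bar> \<le> L * \<bar>x - y\<bar>)"

lemma degree_one_int:
  fixes g :: "real \<Rightarrow> real"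
  assumes "\<And>x. g (x + 1) = g x + 1"
  shows "g (x + of_int k) = g x + of_int k"
proof (induction k rule: int_induct[where k = 0])
  case (step1 i)
  then show ?case using assms[of "x + of_int i"] by (simp add: algebra_simps)
next
  case (step2 i)
  then show ?case using assms[of "x + of_int (i - 1)"] by (simp add: algebra_simps)
qed simp

context
  fixes L :: real and g :: "real \<Rightarrow> real"
  assumes g: "degree_one_lipschitz L g"
begin

lemma dol_add_one: "g (x + 1) = g x + 1"
  and dol_lipschitz: "\<bar>g x - g y\<bar> \<le> L * \<bar>x - y\<bar>"
  using g by (auto simp: degree_one_lipschitz_def)

lemma dol_ge_1: "1 \<le> L"
  using dol_lipschitz[of 1 0] dol_add_one[of 0] by simp

lemma dol_bounded: "\<bar>g x - x - g 0\<bar> \<le> L + 1"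
proof -
  have "g x = g (frac x) + of_int \<lfloor>x\<rfloor>"
    using degree_one_int[of g "frac x" "\<lfloor>x\<rfloor>"] dol_add_one by (simp add: frac_def)
  moreover have "\<bar>g (frac x) - g 0\<bar> \<le> L"
    using dol_lipschitz[of "frac x" 0] frac_lt_1[of x] frac_ge_0[of x] dol_ge_1
      mult_left_le[of "frac x" L] by (smt (verit))
  ultimately show ?thesis
    using frac_lt_1[of x] frac_ge_0[of x] unfolding frac_def by linarith
qed

lemma dol_continuous: "continuous_on S g"
proof (rule continuous_on_subset)
  show "continuous_on UNIV g"
    using dol_lipschitz dol_ge_1
    by (intro lipschitz_on_continuous_on[of L] lipschitz_onI) (auto simp: dist_real_def)
qed simp

lemma dol_bdd_above: "bdd_above (g ` {..x})"
proof (rule bdd_aboveI2)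
  fix y assume "y \<in> {..x}"
  then show "g y \<le> x + g 0 + L + 1" using dol_bounded[of y] by auto
qed

end

section \<open>Monotone envelopes of a degree one map\<close>

definition upper_env :: "(real \<Rightarrow> real) \<Rightarrow> real \<Rightarrow> real" where
  "upper_env g x = (SUP y\<in>{..x}. g y)"

definition lower_env :: "(real \<Rightarrow> real) \<Rightarrow> real \<Rightarrow> real" where
  "lower_env g x = (INF y\<in>{x..}. g y)"

text \<open>Point reflection exchanges the two envelopes, so the facts on \<open>lower_env\<close>
  follow from those on \<open>upper_env\<close> through \<open>dol_reflect\<close>.\<close>

lemma lower_env_eq: "lower_env g x = - upper_env (\<lambda>y. - g (- y)) (- x)"
proof -
  have "(\<lambda>y. - g (- y)) ` {..- x} = uminus ` g ` {x..}"
    by (simp flip: image_uminus_atLeast add: image_image)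
  then show ?thesis
    by (simp add: upper_env_def lower_env_def Inf_real_def image_image)
qed

lemma dol_reflect: "degree_one_lipschitz L g \<Longrightarrow> degree_one_lipschitz L (\<lambda>y. - g (- y))"
  unfolding degree_one_lipschitz_def
proof (intro conjI allI; elim conjE)
  fix x assume "\<forall>x. g (x + 1) = g x + 1"
  from this[rule_format, of "- (x + 1)"] show "- g (- (x + 1)) = - g (- x) + 1" by simp
next
  fix x y assume "\<forall>x y. \<bar>g x - g y\<bar> \<le> L * \<bar>x - y\<bar>"
  from this[rule_format, of "- y" "- x"] show "\<bar>- g (- x) - - g (- y)\<bar> \<le> L * \<bar>x - y\<bar>"
    by (simp add: abs_minus_commute add.commute)
qed

context
  fixes L :: real and g :: "real \<Rightarrow> real"
  assumes g: "degree_one_lipschitz L g"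
begin

lemma upper_env_ge: "y \<le> x \<Longrightarrow> g y \<le> upper_env g x"
  unfolding upper_env_def by (rule cSUP_upper[OF _ dol_bdd_above[OF g]]) simp

lemma upper_env_least: "(\<And>y. y \<le> x \<Longrightarrow> g y \<le> c) \<Longrightarrow> upper_env g x \<le> c"
  unfolding upper_env_def by (rule cSUP_least) auto

lemma upper_env_mono: "x \<le> y \<Longrightarrow> upper_env g x \<le> upper_env g y"
  by (intro upper_env_least upper_env_ge) simp

lemma upper_env_add_one: "upper_env g (x + 1) = upper_env g x + 1"
proof (rule antisym)
  show "upper_env g (x + 1) \<le> upper_env g x + 1"
  proof (rule upper_env_least)
    fix y assume "y \<le> x + 1"
    then show "g y \<le> upper_env g x + 1"
      using upper_env_ge[of "y - 1" x] dol_add_one[OF g, of "y - 1"] by simp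
  qed
  have "upper_env g x \<le> upper_env g (x + 1) - 1"
  proof (rule upper_env_least)
    fix y assume "y \<le> x"
    then show "g y \<le> upper_env g (x + 1) - 1"
      using upper_env_ge[of "y + 1" "x + 1"] dol_add_one[OF g, of y] by simp
  qed
  then show "upper_env g x + 1 \<le> upper_env g (x + 1)" by simp
qed

text \<open>Passing from \<open>x\<close> to \<open>y\<close> adds only points in between to the
  supremum, where \<open>g\<close> exceeds \<open>g x\<close> by at most
  \<open>L * (y - x)\<close>.\<close>

lemma upper_env_dol: "degree_one_lipschitz L (upper_env g)"
proof -
  have step: "upper_env g y \<le> upper_env g x + L * (y - x)" if "x \<le> y" for x y
  proof (rule upper_env_least)
    fix z assume "z \<le> y"
    show "g z \<le> upper_env g x + L * (y - x)"
    proof (cases "z \<le> x")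
      case True
      have "0 \<le> L * (y - x)" using that dol_ge_1[OF g] by simp
      with upper_env_ge[OF True] show ?thesis by linarith
    next
      case False
      then have "g z - g x \<le> L * (z - x)" using dol_lipschitz[OF g, of z x] by simp
      also have "\<dots> \<le> L * (y - x)" using \<open>z \<le> y\<close> dol_ge_1[OF g] by simp
      finally show ?thesis using upper_env_ge[of x x] by simp
    qed
  qed
  have "\<bar>upper_env g x - upper_env g y\<bar> \<le> L * \<bar>x - y\<bar>" for x y
    by (cases "x \<le> y")
       (use step[of x y] step[of y x] upper_env_mono[of x y] upper_env_mono[of y x]
        in \<open>simp_all add: abs_minus_commute\<close>)
  then show ?thesis by (simp add: degree_one_lipschitz_def upper_env_add_one)
qed

text \<open>If \<open>g x < v\<close>, then \<open>g\<close> stays away from \<open>v\<close> on a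
  short interval to the left of \<open>x\<close>, so the envelope would have to reach
  \<open>v\<close> before \<open>x\<close>.\<close>

lemma upper_env_first:
  assumes "upper_env g x = v" "\<And>y. y < x \<Longrightarrow> upper_env g y < v"
  shows "g x = v"
proof (rule ccontr)
  assume "g x \<noteq> v"
  then have lt: "g x < v" using upper_env_ge[of x x] assms(1) by simp
  \<comment> \<open>Within distance \<open>d\<close> to the left of \<open>x\<close> the Lipschitz
    bound keeps \<open>g\<close> at most at the midpoint of \<open>g x\<close> and
    \<open>v\<close>.\<close>
  define d where "d = (v - g x) / (2 * L)"
  have L: "L > 0" using dol_ge_1[OF g] by simp
  have d: "d > 0" "L * d = (v - g x) / 2" using lt L by (auto simp: d_def)
  have "upper_env g x \<le> max (upper_env g (x - d)) ((v + g x) / 2)"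
  proof (rule upper_env_least)
    fix y assume "y \<le> x"
    show "g y \<le> max (upper_env g (x - d)) ((v + g x) / 2)"
    proof (cases "y \<le> x - d")
      case True
      then show ?thesis using upper_env_ge[OF True] by simp
    next
      case False
      then have "g y - g x \<le> L * (x - y)"
        using dol_lipschitz[OF g, of y x] \<open>y \<le> x\<close> by simp
      also have "\<dots> \<le> L * d" using False L by simp
      finally have "g y \<le> (v + g x) / 2" using d(2) by (simp add: field_simps)
      then show ?thesis by (rule max.coboundedI2)
    qed
  qed
  then show False using assms(2)[of "x - d"] assms(1) d(1) lt by (auto simp: max_def split: if_splits)
qed

end

context
  fixes L :: real and g :: "real \<Rightarrow> real"
  assumes g: "degree_one_lipschitz L g"
begin

lemma lower_env_le: "x \<le> y \<Longrightarrow> lower_env g x \<le> g y"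
  using upper_env_ge[OF dol_reflect[OF g], of "- y" "- x"] by (simp add: lower_env_eq)

lemma lower_env_greatest: "(\<And>y. x \<le> y \<Longrightarrow> c \<le> g y) \<Longrightarrow> c \<le> lower_env g x"
  using upper_env_least[OF dol_reflect[OF g], of "- x" "- c"] by (simp add: lower_env_eq)

lemma lower_env_mono: "x \<le> y \<Longrightarrow> lower_env g x \<le> lower_env g y"
  using upper_env_mono[OF dol_reflect[OF g], of "- y" "- x"] by (simp add: lower_env_eq)

lemma lower_env_dol: "degree_one_lipschitz L (lower_env g)"
  using dol_reflect[OF upper_env_dol[OF dol_reflect[OF g]]] by (simp add: lower_env_eq[abs_def])

end

text \<open>For \<mu> = 0 the minimum is the lower envelope, already monotone; once \<mu> bounds
  \<open>h - lower_env h\<close> it is \<open>h\<close> itself, and the truncation is the upper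
  envelope.\<close>

definition truncation :: "(real \<Rightarrow> real) \<Rightarrow> real \<Rightarrow> real \<Rightarrow> real" where
  "truncation h \<mu> = upper_env (\<lambda>y. min (h y) (lower_env h y + \<mu>))"

text \<open>The level set of \<open>v\<close> is compact, and non-empty by the intermediate value
  theorem; \<open>a\<close> and \<open>b\<close> are its least and greatest points.\<close>

lemma degree_one_surj_threshold:
  assumes "degree_one_lipschitz L g" and mono: "\<And>x y. x \<le> y \<Longrightarrow> g x \<le> g y"
  obtains a b where "a \<le> b" "g a = v" "g b = v" "\<And>y. y < a \<Longrightarrow> g y < v" "\<And>y. b < y \<Longrightarrow> v < g y"
proof -
  note g = assms(1)
  \<comment> \<open>By \<open>dol_bounded\<close>, \<open>g x\<close> differs from \<open>x\<close>
    by at most \<open>\<bar>g 0\<bar> + L + 1\<close>, so the level set of \<open>v\<close> lies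
    between \<open>- B\<close> and \<open>B\<close>.\<close>
  define B where "B = \<bar>v\<bar> + \<bar>g 0\<bar> + L + 2"
  have lo: "g x < v" if "x \<le> - B" for x
    using that dol_bounded[OF g, of x] by (simp add: B_def)
  have hi: "v < g x" if "x \<ge> B" for x
    using that dol_bounded[OF g, of x] by (simp add: B_def)
  have "B \<ge> 0" using dol_ge_1[OF g] by (simp add: B_def)
  define S where "S = g -` {v}"
  have "closed S" unfolding S_def
    by (rule continuous_closed_vimage) (use dol_continuous[OF g, of UNIV] in \<open>auto simp: continuous_on_eq_continuous_at\<close>)
  moreover have "S \<subseteq> {- B..B}" using lo hi unfolding S_def by (smt (verit) atLeastAtMost_iff subsetI vimage_singleton_eq)
  ultimately have cS: "compact S"
    by (metis compact_Icc compact_Int_closed inf.absorb_iff2)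
  have "\<exists>x\<ge>- B. x \<le> B \<and> g x = v"
    using lo[of "- B"] hi[of B] \<open>B \<ge> 0\<close> by (intro IVT' dol_continuous[OF g]) auto
  then have "S \<noteq> {}" by (auto simp: S_def)
  obtain a where a: "a \<in> S" "\<And>t. t \<in> S \<Longrightarrow> a \<le> t"
    using compact_attains_inf[OF cS \<open>S \<noteq> {}\<close>] by blast
  obtain b where b: "b \<in> S" "\<And>t. t \<in> S \<Longrightarrow> t \<le> b"
    using compact_attains_sup[OF cS \<open>S \<noteq> {}\<close>] by blast
  show ?thesis
  proof (rule that[of a b])
    show "a \<le> b" "g a = v" "g b = v" using a b by (auto simp: S_def)
    show "g y < v" if "y < a" for y
    proof -
      have "g y \<noteq> v" using a(2)[of y] that by (auto simp: S_def)
      then show ?thesis using mono[of y a] that \<open>g a = v\<close> by simp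
    qed
    show "v < g y" if "b < y" for y
    proof -
      have "g y \<noteq> v" using b(2)[of y] that by (auto simp: S_def)
      then show ?thesis using mono[of b y] that \<open>g b = v\<close> by simp
    qed
  qed
qed

section \<open>Properties of the truncations\<close>

context
  fixes L :: real and h :: "real \<Rightarrow> real"
  assumes h: "degree_one_lipschitz L h"
begin

lemma truncation_base_dol: "degree_one_lipschitz L (\<lambda>y. min (h y) (lower_env h y + \<mu>))"
proof -
  have "\<bar>min a (b + \<mu>) - min c (d + \<mu>)\<bar> \<le> e" if "\<bar>a - c\<bar> \<le> e" "\<bar>b - d\<bar> \<le> e" for a b c d e :: real
    using that by linarith
  then show ?thesis
    using h lower_env_dol[OF h] unfolding degree_one_lipschitz_def by (simp add: min_def)
qed

lemma truncation_dol: "degree_one_lipschitz L (truncation h \<mu>)"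
  unfolding truncation_def by (rule upper_env_dol[OF truncation_base_dol])

lemma truncation_mono: "x \<le> y \<Longrightarrow> truncation h \<mu> x \<le> truncation h \<mu> y"
  unfolding truncation_def by (rule upper_env_mono[OF truncation_base_dol])

lemma truncation_le: "truncation h \<mu> x \<le> lower_env h x + \<mu>"
  unfolding truncation_def
proof (rule upper_env_least[OF truncation_base_dol])
  fix y assume "y \<le> x"
  then show "min (h y) (lower_env h y + \<mu>) \<le> lower_env h x + \<mu>"
    using lower_env_mono[OF h, of y x] by linarith
qed

text \<open>Together with \<open>truncation_ge_upper_env\<close> this places \<open>h\<close>
  between two monotone maps of the family, which will bound the rotation set.\<close>

lemma truncation_zero_le: "truncation h 0 x \<le> h x"
  using truncation_le[of 0 x] lower_env_le[OF h, of x x] by simp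

lemma truncation_ge_upper_env:
  assumes "\<And>y. h y \<le> lower_env h y + \<mu>"
  shows "upper_env h x \<le> truncation h \<mu> x"
proof -
  have "(\<lambda>y. min (h y) (lower_env h y + \<mu>)) = h" using assms by (auto simp: min_def)
  then show ?thesis by (simp add: truncation_def)
qed

lemma truncation_bound_exists: "\<exists>K\<ge>0. \<forall>y. h y \<le> lower_env h y + K"
proof (intro exI conjI allI)
  show "0 \<le> 2 * (L + 1)" using dol_ge_1[OF h] by simp
  fix y
  have "h y - 2 * (L + 1) \<le> lower_env h y"
  proof (rule lower_env_greatest[OF h])
    fix z assume "y \<le> z"
    then show "h y - 2 * (L + 1) \<le> h z"
      using dol_bounded[OF h, of y] dol_bounded[OF h, of z] by simp
  qed
  then show "h y \<le> lower_env h y + 2 * (L + 1)" by simp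
qed

text \<open>The bound is uniform in \<open>x\<close>; the continuity of the rotation number in \<mu>
  rests on it.\<close>

lemma truncation_param_lipschitz: "\<bar>truncation h \<mu> x - truncation h \<nu> x\<bar> \<le> \<bar>\<mu> - \<nu>\<bar>"
proof -
  have "truncation h \<mu> x \<le> truncation h \<nu> x + \<bar>\<mu> - \<nu>\<bar>" for \<mu> \<nu>
    unfolding truncation_def
  proof (rule upper_env_least[OF truncation_base_dol])
    fix y assume "y \<le> x"
    from upper_env_ge[OF truncation_base_dol this, of \<nu>]
    show "min (h y) (lower_env h y + \<mu>)
        \<le> upper_env (\<lambda>y. min (h y) (lower_env h y + \<nu>)) x + \<bar>\<mu> - \<nu>\<bar>" by linarith
  qed
  from this[of \<mu> \<nu>] this[of \<nu> \<mu>] show ?thesis by linarith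
qed

text \<open>The truncation equals \<open>v\<close> on a closed interval with \<open>h \<ge> v\<close> at its left and \<open>h \<le> v\<close> at its
  right end point, so that \<open>h\<close> takes the value \<open>v\<close> in between. The latter inequality fails for \<open>\<mu> < 0\<close>.\<close>

lemma truncation_hits:
  assumes "0 \<le> \<mu>"
  shows "\<exists>x. truncation h \<mu> x = v \<and> h x = v"
proof -
  let ?G = "\<lambda>y. min (h y) (lower_env h y + \<mu>)"
  let ?T = "truncation h \<mu>"
  obtain a b where ab: "a \<le> b" "?T a = v" "?T b = v"
    "\<And>y. y < a \<Longrightarrow> ?T y < v" "\<And>y. b < y \<Longrightarrow> v < ?T y"
    using degree_one_surj_threshold[OF truncation_dol truncation_mono] by metis
  \<comment> \<open>\<open>a\<close> is the first point where the truncation reaches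
    \<open>v\<close>, so the value is attained there by the capped function itself.\<close>
  have "?G a = v"
    by (rule upper_env_first[OF truncation_base_dol]) (use ab in \<open>auto simp: truncation_def\<close>)
  then have ha: "v \<le> h a" by linarith
  have hb: "h b \<le> v"
  proof (rule ccontr)
    \<comment> \<open>If \<open>h b > v\<close>, the cap \<open>lower_env h b + \<mu>\<close> is
      what holds the truncation at \<open>v\<close>. Just to the right of \<open>b\<close> the map
      \<open>h\<close> stays above \<open>c\<close>, so the lower envelope cannot rise there and the
      truncation remains at most \<open>v\<close>, although \<open>b\<close> is the last such
      point.\<close>
    assume "\<not> h b \<le> v"
    then have hv: "h b > v" by simp
    have L: "L > 0" using dol_ge_1[OF h] by simp
    define d where "d = (h b - v) / (2 * L)"
    define c where "c = (h b + v) / 2"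
    have c: "v < c" using hv by (simp add: c_def)
    have d: "d > 0" "L * d = h b - c" using hv L by (auto simp: d_def c_def field_simps)
    have "?G b \<le> v" using upper_env_ge[OF truncation_base_dol, of b b \<mu>] ab(3) by (simp add: truncation_def)
    then have lb: "lower_env h b + \<mu> = v"
      using hv truncation_le[of \<mu> b] ab(3) by linarith
    have "?T (b + d) \<le> v"
      unfolding truncation_def
    proof (rule upper_env_least[OF truncation_base_dol])
      fix y assume y: "y \<le> b + d"
      show "?G y \<le> v"
      proof (cases "y \<le> b")
        case True
        then show ?thesis
          using upper_env_ge[OF truncation_base_dol True, of \<mu>] ab(3) by (simp add: truncation_def)
      next
        case False
        have hz: "c \<le> h z" if "b \<le> z" "z \<le> y" for z
        proof -
          have "h b - h z \<le> L * (z - b)" using dol_lipschitz[OF h, of b z] that by simp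
          also have "\<dots> \<le> L * d" using that y L by simp
          finally show ?thesis using d by simp
        qed
        \<comment> \<open>The infimum of \<open>h\<close> from \<open>b\<close> on splits into
          points up to \<open>y\<close>, where \<open>h\<close> is at least \<open>c\<close>, and
          points beyond. As \<mu> \<ge> 0 gives \<open>lower_env h b \<le> v < c\<close>, the first
          part does not realise it.\<close>
        have "min c (lower_env h y) \<le> lower_env h b"
          by (rule lower_env_greatest[OF h])
             (metis hz lower_env_le[OF h] min.coboundedI1 min.coboundedI2 nle_le)
        then show ?thesis using c lb assms by linarith
      qed
    qed
    then show False using ab(5)[of "b + d"] d by simp
  qed
  have "\<exists>x\<ge>a. x \<le> b \<and> h x = v"
    using ha hb ab(1) by (intro IVT2' dol_continuous[OF h]) auto
  then obtain x where x: "a \<le> x" "x \<le> b" "h x = v" by blast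
  have "?T x = v" using truncation_mono[OF x(1), of \<mu>] truncation_mono[OF x(2), of \<mu>] ab(2,3) by linarith
  with x show ?thesis by blast
qed

end

section \<open>Rotation numbers of monotone cocycles over an irrational rotation\<close>

lemma sin2pi_circle_of: "sin2pi (circle_of x) = sin (2 * pi * x)"
  by transfer simp

lemma dist_circle_add: "dist (a + c) (b + c) = dist a (b :: circle)"
  by transfer simp

lemma dist_circle_le_1: "dist a (b :: circle) \<le> 1"
proof -
  obtain x y where "a = circle_of x" "b = circle_of y" using circle_of_surj by metis
  then show ?thesis
    using of_int_round_abs_le[of "x - y"] by (simp add: dist_circle_of abs_minus_commute)
qed

lemma circle_dist_representative:
  obtains y where "c = circle_of y" "\<bar>y - x\<bar> = dist c (circle_of x)"
proof -
  obtain z where z: "c = circle_of z" using circle_of_surj by blast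
  show ?thesis
  proof (rule that)
    show "c = circle_of (z - of_int (round (z - x)))" unfolding z circle_of_eq_iff by simp
    show "\<bar>z - of_int (round (z - x)) - x\<bar> = dist c (circle_of x)"
      unfolding z dist_circle_of by (simp add: algebra_simps)
  qed
qed

lemma circle_of_of_int_add: "circle_of (x + of_int k) = circle_of x"
  by (simp add: circle_of_eq_iff)

lemma abs_sin_diff_le_abs_diff: "\<bar>sin a - sin b\<bar> \<le> \<bar>a - (b :: real)\<bar>"
proof -
  have "\<bar>sin a - sin b\<bar> = 2 * \<bar>sin ((a - b) / 2)\<bar> * \<bar>cos ((a + b) / 2)\<bar>"
    by (simp add: sin_diff_sin abs_mult)
  also have "\<dots> \<le> 2 * \<bar>(a - b) / 2\<bar> * 1"
    by (intro mult_mono abs_sin_x_le_abs_x) auto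
  finally show ?thesis by simp
qed

lemma sin2pi_lipschitz: "\<bar>sin2pi a - sin2pi b\<bar> \<le> 2 * pi * dist a b"
proof -
  obtain x where x: "b = circle_of x" using circle_of_surj by blast
  obtain y where y: "a = circle_of y" "\<bar>y - x\<bar> = dist a b"
    using circle_dist_representative[of a x] x by metis
  have "\<bar>sin (2 * pi * y) - sin (2 * pi * x)\<bar> \<le> \<bar>2 * pi * y - 2 * pi * x\<bar>"
    by (rule abs_sin_diff_le_abs_diff)
  also have "\<dots> = 2 * pi * \<bar>y - x\<bar>" by (simp add: abs_mult flip: right_diff_distrib)
  finally show ?thesis using x y by (simp add: sin2pi_circle_of)
qed

lemma funpow_rotation: "((\<lambda>\<theta>. \<theta> + \<omega>) ^^ n) \<theta> = \<theta> + ((\<lambda>\<theta>. \<theta> + \<omega>) ^^ n) (0 :: circle)"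
  by (induction n) (simp_all add: add.assoc)

lemma funpow_rotation_circle_of: "((\<lambda>\<theta>. \<theta> + circle_of w) ^^ n) \<theta> = \<theta> + circle_of (real n * w)"
proof (induction n)
  case 0
  have "circle_of 0 = 0" by transfer (simp add: int_equiv_def)
  then show ?case by simp
next
  case (Suc n)
  then show ?case by (simp add: algebra_simps circle_of_add)
qed

lemma dist_funpow_rotation:
  "dist (((\<lambda>\<theta>. \<theta> + \<omega>) ^^ n) \<theta>) (((\<lambda>\<theta>. \<theta> + \<omega>) ^^ n) \<theta>') = dist \<theta> (\<theta>' :: circle)"
  by (subst (1 2) funpow_rotation) (simp add: dist_circle_add)

text \<open>Kronecker's theorem made uniform: by compactness finitely many times serve all targets,
  and translation invariance makes them independent of the starting point.\<close>

lemma irrational_rotation_dense: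
  assumes "\<omega> \<notin> circle_of ` \<rat>" "\<delta> > 0"
  obtains J where "\<And>\<theta> \<theta>'. \<exists>j\<le>J. dist (((\<lambda>\<theta>. \<theta> + \<omega>) ^^ j) \<theta>) \<theta>' < \<delta>"
proof -
  obtain w where w: "\<omega> = circle_of w" using circle_of_surj by blast
  with assms(1) have "w \<notin> \<rat>" by blast
  have ex: "\<exists>k. dist (circle_of (real k * w)) c < \<delta> / 2" for c
  proof -
    obtain \<alpha> where \<alpha>: "c = circle_of \<alpha>" using circle_of_surj by blast
    obtain h k where k: "k > 0" "\<bar>of_int k * w - of_int h - \<alpha>\<bar> < \<delta> / 2"
      using sequence_of_fractional_parts_is_dense[OF \<open>w \<notin> \<rat>\<close>, of "\<delta> / 2" \<alpha>]
        half_gt_zero[OF assms(2)] by metis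
    have "circle_of (real (nat k) * w) = circle_of (of_int k * w - of_int h)"
      using k(1) by (simp add: circle_of_eq_iff)
    moreover have "dist (circle_of (of_int k * w - of_int h)) (circle_of \<alpha>) < \<delta> / 2"
      using dist_circle_of_le[of "of_int k * w - of_int h" \<alpha>] k(2) by (simp add: dist_real_def)
    ultimately have "dist (circle_of (real (nat k) * w)) c < \<delta> / 2" by (simp add: \<alpha>)
    then show ?thesis by blast
  qed
  then obtain k where k: "\<And>c. dist (circle_of (real (k c) * w)) c < \<delta> / 2" by metis
  have cover: "(UNIV :: circle set) \<subseteq> (\<Union>c\<in>UNIV. ball c (\<delta> / 2))" using assms(2) by auto
  obtain T where T: "finite T" "(UNIV :: circle set) \<subseteq> (\<Union>c\<in>T. ball c (\<delta> / 2))"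
    using compactE_image[OF compact_UNIV_circle _ cover] open_ball by metis
  show ?thesis
  proof (rule that[of "Max (insert 0 (k ` T))"])
    fix \<theta> \<theta>'
    \<comment> \<open>Reaching \<theta>' from \<theta> amounts to reaching \<theta>' - \<theta> from
      0.\<close>
    have "\<theta>' - \<theta> \<in> (\<Union>c\<in>T. ball c (\<delta> / 2))" using T(2) by blast
    then obtain c where c: "c \<in> T" "dist c (\<theta>' - \<theta>) < \<delta> / 2" by auto
    have "dist (circle_of (real (k c) * w)) (\<theta>' - \<theta>) < \<delta>"
      using k[of c] c(2) dist_triangle_half_r by (metis dist_commute dist_triangle_half_l)
    then have "dist (circle_of (real (k c) * w) + \<theta>) (\<theta>' - \<theta> + \<theta>) < \<delta>"
      by (simp only: dist_circle_add)
    moreover have "k c \<le> Max (insert 0 (k ` T))" using c T(1) by (intro Max_ge) auto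
    ultimately show "\<exists>j\<le>Max (insert 0 (k ` T)). dist (((\<lambda>\<theta>. \<theta> + \<omega>) ^^ j) \<theta>) \<theta>' < \<delta>"
      by (auto simp: w funpow_rotation_circle_of add.commute)
  qed
qed

text \<open>Convergence uniform in base and fibre, multiplied by \<open>n\<close> so that no
  quotient occurs.\<close>

definition uniform_rotation :: "circle \<Rightarrow> (circle \<Rightarrow> real \<Rightarrow> real) \<Rightarrow> real \<Rightarrow> bool" where
  "uniform_rotation \<omega> E r \<longleftrightarrow>
     (\<forall>e>0. \<exists>N. \<forall>n\<ge>N. \<forall>\<theta> x. \<bar>fib_iterate \<omega> E n \<theta> x - x - real n * r\<bar> \<le> e * real n)"

lemma fib_iterate_add:
  "fib_iterate \<omega> E (m + n) \<theta> x
     = fib_iterate \<omega> E n (((\<lambda>\<theta>. \<theta> + \<omega>) ^^ m) \<theta>) (fib_iterate \<omega> E m \<theta> x)"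
proof (induction n)
  case (Suc n)
  have "((\<lambda>\<theta>. \<theta> + \<omega>) ^^ (m + n)) \<theta> = ((\<lambda>\<theta>. \<theta> + \<omega>) ^^ n) (((\<lambda>\<theta>. \<theta> + \<omega>) ^^ m) \<theta>)"
    by (subst add.commute) (simp add: funpow_add)
  with Suc show ?case by simp
qed simp

section \<open>Displacements of iterates and existence of the rotation number\<close>

locale monotone_cocycle =
  fixes \<omega> :: circle and E :: "circle \<Rightarrow> real \<Rightarrow> real" and L :: real
  assumes irrational: "\<omega> \<notin> circle_of ` \<rat>"
    and add_one: "E \<theta> (x + 1) = E \<theta> x + 1"
    and mono: "x \<le> y \<Longrightarrow> E \<theta> x \<le> E \<theta> y"
    and lipschitz: "\<bar>E \<theta> x - E \<theta>' x'\<bar> \<le> L * (dist \<theta> \<theta>' + \<bar>x - x'\<bar>)"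
begin

abbreviation rot :: "nat \<Rightarrow> circle \<Rightarrow> circle" where
  "rot n \<equiv> (\<lambda>\<theta>. \<theta> + \<omega>) ^^ n"

abbreviation iter :: "nat \<Rightarrow> circle \<Rightarrow> real \<Rightarrow> real" where
  "iter \<equiv> fib_iterate \<omega> E"

lemma fibre_dol: "degree_one_lipschitz L (E \<theta>)"
  using add_one lipschitz[of \<theta> _ \<theta>] by (simp add: degree_one_lipschitz_def)

lemma L_ge_1: "1 \<le> L"
  using dol_ge_1[OF fibre_dol] .

lemma iter_add_one: "iter n \<theta> (x + 1) = iter n \<theta> x + 1"
  by (induction n) (simp_all add: add_one)

lemma iter_add_int: "iter n \<theta> (x + of_int k) = iter n \<theta> x + of_int k"
  by (rule degree_one_int) (rule iter_add_one)

lemma iter_mono: "x \<le> y \<Longrightarrow> iter n \<theta> x \<le> iter n \<theta> y"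
  by (induction n) (simp_all add: mono)

text \<open>The rotation is an isometry, so only fibre distances grow. The constant depends on
  \<open>n\<close>, which suffices because it is applied at bounded times.\<close>

lemma iter_lipschitz:
  obtains C where "C > 0" "\<And>\<theta> x \<theta>' x'. \<bar>iter n \<theta> x - iter n \<theta>' x'\<bar> \<le> C * (dist \<theta> \<theta>' + \<bar>x - x'\<bar>)"
proof -
  have "\<exists>C>0. \<forall>\<theta> x \<theta>' x'. \<bar>iter n \<theta> x - iter n \<theta>' x'\<bar> \<le> C * (dist \<theta> \<theta>' + \<bar>x - x'\<bar>)"
  proof (induction n)
    case 0
    show ?case by (intro exI[of _ 1]) simp
  next
    case (Suc n)
    then obtain C where C: "C > 0"
      "\<And>\<theta> x \<theta>' x'. \<bar>iter n \<theta> x - iter n \<theta>' x'\<bar> \<le> C * (dist \<theta> \<theta>' + \<bar>x - x'\<bar>)" by blast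
    have "\<bar>iter (Suc n) \<theta> x - iter (Suc n) \<theta>' x'\<bar> \<le> L * (1 + C) * (dist \<theta> \<theta>' + \<bar>x - x'\<bar>)" for \<theta> x \<theta>' x'
    proof -
      let ?d = "dist \<theta> \<theta>' + \<bar>x - x'\<bar>"
      have "\<bar>iter (Suc n) \<theta> x - iter (Suc n) \<theta>' x'\<bar> \<le> L * (dist \<theta> \<theta>' + \<bar>iter n \<theta> x - iter n \<theta>' x'\<bar>)"
        using lipschitz[of "rot n \<theta>" "iter n \<theta> x" "rot n \<theta>'" "iter n \<theta>' x'"]
        by (simp add: dist_funpow_rotation)
      also have "\<dots> \<le> L * (?d + C * ?d)"
        using C(2)[of \<theta> x \<theta>' x'] L_ge_1 by (intro mult_left_mono add_mono) auto
      finally show ?thesis by (simp add: algebra_simps)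
    qed
    then show ?case using C(1) L_ge_1 by (intro exI[of _ "L * (1 + C)"]) auto
  qed
  then show ?thesis using that by blast
qed

text \<open>The displacement has period one in \<open>x\<close>, and a monotone degree one map sends
  a gap between 0 and 1 to such a gap. That the bound does not depend on \<open>n\<close> is the
  reason why rotation numbers exist.\<close>

lemma iter_disp: "\<bar>(iter n \<theta> x - x) - (iter n \<theta> y - y)\<bar> \<le> 1"
proof -
  define z where "z = y + of_int \<lfloor>x - y\<rfloor>"
  have "iter n \<theta> z - z = iter n \<theta> y - y" by (simp add: z_def iter_add_int)
  moreover have "z \<le> x" "x \<le> z + 1" unfolding z_def by linarith+
  moreover have "iter n \<theta> z \<le> iter n \<theta> x" "iter n \<theta> x \<le> iter n \<theta> z + 1"
    using iter_mono[OF \<open>z \<le> x\<close>] iter_mono[OF \<open>x \<le> z + 1\<close>] by (simp_all add: iter_add_one)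
  ultimately show ?thesis by linarith
qed

lemma iter_bound:
  obtains K where "K > 0" "\<And>n \<theta> x. \<bar>iter n \<theta> x - x\<bar> \<le> real n * K"
proof -
  define K where "K = \<bar>E 0 0\<bar> + 2 * L + 1"
  have E: "\<bar>E \<theta> x - x\<bar> \<le> K" for \<theta> x
  proof -
    have "L * dist \<theta> 0 \<le> L" using dist_circle_le_1[of \<theta> 0] L_ge_1 by simp
    then show ?thesis
      using dol_bounded[OF fibre_dol, of \<theta> x] lipschitz[of \<theta> 0 0 0] unfolding K_def by simp
  qed
  have "\<bar>iter n \<theta> x - x\<bar> \<le> real n * K" for n \<theta> x
  proof (induction n)
    case (Suc n)
    then show ?case using E[of "rot n \<theta>" "iter n \<theta> x"] by (simp add: algebra_simps)
  qed simp
  moreover have "K > 0" using L_ge_1 by (simp add: K_def)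
  ultimately show ?thesis using that by blast
qed

lemma iter_block:
  assumes "\<And>\<theta> x. \<bar>iter m \<theta> x - x - c\<bar> \<le> \<eta>"
  shows "\<bar>iter (k * m) \<theta> x - x - real k * c\<bar> \<le> real k * \<eta>"
proof (induction k)
  case (Suc k)
  have "iter (Suc k * m) \<theta> x = iter m (rot (k * m) \<theta>) (iter (k * m) \<theta> x)"
    using fib_iterate_add[of \<omega> E "k * m" m \<theta> x] by (simp add: add.commute)
  then show ?case
    using Suc assms[of "rot (k * m) \<theta>" "iter (k * m) \<theta> x"] by (simp add: algebra_simps)
qed simp

text \<open>Nearby base points are compared in blocks of length \<open>m\<close>: closeness costs 1
  per block and two uses of \<open>iter_disp\<close> cost 2. Arbitrary base points become close
  after at most \<open>J\<close> rotations, at bounded cost.\<close>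

lemma iter_oscillation:
  assumes "e > 0"
  obtains N where "\<And>n \<theta> \<theta>' x x'. n \<ge> N \<Longrightarrow> \<bar>(iter n \<theta> x - x) - (iter n \<theta>' x' - x')\<bar> \<le> e * real n"
proof -
  obtain K where K: "K > 0" "\<And>n \<theta> x. \<bar>iter n \<theta> x - x\<bar> \<le> real n * K"
    using iter_bound by blast
  \<comment> \<open>With \<open>m > 6 / e\<close> the cost of 3 per block amounts to at most half of
    the allowed \<open>e * n\<close>.\<close>
  obtain m :: nat where m: "6 / e < real m" using reals_Archimedean2 by blast
  then have m0: "m > 0" using assms by (cases m) (auto simp: field_simps)
  obtain C where C: "C > 0"
    "\<And>\<theta> x \<theta>' x'. \<bar>iter m \<theta> x - iter m \<theta>' x'\<bar> \<le> C * (dist \<theta> \<theta>' + \<bar>x - x'\<bar>)"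
    using iter_lipschitz[of m] by metis
  have near: "\<bar>iter (k * m) \<theta> 0 - iter (k * m) \<theta>' 0\<bar> \<le> 3 * real k" if "dist \<theta> \<theta>' < 1 / C" for k \<theta> \<theta>'
  proof (induction k)
    case (Suc k)
    have eq: "iter (Suc k * m) \<theta> 0 = iter m (rot (k * m) \<theta>) (iter (k * m) \<theta> 0)" for \<theta>
      using fib_iterate_add[of \<omega> E "k * m" m \<theta> 0] by (simp add: add.commute)
    have "\<bar>iter m (rot (k * m) \<theta>) 0 - iter m (rot (k * m) \<theta>') 0\<bar> \<le> C * dist \<theta> \<theta>'"
      using C(2)[of "rot (k * m) \<theta>" 0 "rot (k * m) \<theta>'" 0] by (simp add: dist_funpow_rotation)
    also have "\<dots> \<le> 1" using that C(1) by (simp add: field_simps)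
    finally show ?case
      using Suc iter_disp[of m "rot (k * m) \<theta>" "iter (k * m) \<theta> 0" 0]
        iter_disp[of m "rot (k * m) \<theta>'" "iter (k * m) \<theta>' 0" 0]
      unfolding eq by simp
  qed simp
  obtain J where J: "\<And>\<theta> \<theta>'. \<exists>j\<le>J. dist (rot j \<theta>) \<theta>' < 1 / C"
    using irrational_rotation_dense[OF irrational, of "1 / C"] C(1) by auto
  \<comment> \<open>The bounded errors: \<open>2 * real m * K\<close> from cutting two orbits to
    full blocks, \<open>2 * real J * K + 1\<close> from the shift by \<open>j\<close>, and 2 from
    replacing \<open>x\<close> and \<open>x'\<close> by 0.\<close>
  define B where "B = 2 * real m * K + 2 * real J * K + 3"
  obtain N :: nat where N: "2 * B / e < real N" using reals_Archimedean2 by blast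
  show ?thesis
  proof (rule that[of N])
    fix n \<theta> \<theta>' x x' assume "n \<ge> N"
    define k where "k = n div m"
    have n_eq: "n = k * m + n mod m" by (simp add: k_def)
    have trunc: "\<bar>iter n \<theta> 0 - iter (k * m) \<theta> 0\<bar> \<le> real m * K" for \<theta>
    proof -
      have "iter n \<theta> 0 = iter (n mod m) (rot (k * m) \<theta>) (iter (k * m) \<theta> 0)"
        by (subst n_eq) (rule fib_iterate_add)
      then have "\<bar>iter n \<theta> 0 - iter (k * m) \<theta> 0\<bar> \<le> real (n mod m) * K" using K(2) by simp
      also have "\<dots> \<le> real m * K" using K(1) m0 by (intro mult_right_mono) auto
      finally show ?thesis .
    qed
    obtain j where j: "j \<le> J" "dist (rot j \<theta>) \<theta>' < 1 / C" using J by blast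
    have jK: "real j * K \<le> real J * K" using j(1) K(1) by simp
    \<comment> \<open>Both sides are the iterate of 0 over \<open>j + n\<close> steps, split in the
      two possible orders.\<close>
    have "iter n (rot j \<theta>) (iter j \<theta> 0) = iter j (rot n \<theta>) (iter n \<theta> 0)"
      using fib_iterate_add[of \<omega> E j n \<theta> 0] fib_iterate_add[of \<omega> E n j \<theta> 0] by (simp add: add.commute)
    then have shift: "\<bar>iter n (rot j \<theta>) 0 - iter n \<theta> 0\<bar> \<le> 2 * real J * K + 1"
      using K(2)[of j "rot n \<theta>" "iter n \<theta> 0"] K(2)[of j \<theta> 0] jK
        iter_disp[of n "rot j \<theta>" "iter j \<theta> 0" 0] by simp
    have "real k * real m \<le> real n" using n_eq by (metis le_add1 of_nat_le_iff of_nat_mult)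
    then have "3 * real k \<le> e / 2 * real n"
    proof -
      have "6 \<le> e * real m" using m assms by (simp add: field_simps)
      from mult_right_mono[OF this, of "real k"] have "3 * real k * 2 \<le> (e * real m) * real k" by simp
      also have "\<dots> \<le> e * real n" using \<open>real k * real m \<le> real n\<close> assms by (simp add: mult.assoc mult.commute)
      finally show ?thesis by simp
    qed
    moreover have "B \<le> e / 2 * real n"
    proof -
      have "2 * B / e \<le> real n" using N \<open>n \<ge> N\<close> by simp
      then show ?thesis using assms by (simp add: field_simps)
    qed
    ultimately show "\<bar>(iter n \<theta> x - x) - (iter n \<theta>' x' - x')\<bar> \<le> e * real n"
      using near[OF j(2), of k] trunc[of \<theta>'] trunc[of "rot j \<theta>"] shift
        iter_disp[of n \<theta> x 0] iter_disp[of n \<theta>' x' 0]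
      unfolding B_def by simp
  qed
qed

text \<open>By \<open>iter_oscillation\<close> the displacement \<open>d\<close> over one long block
  is representative for all blocks; the remainder of the division by \<open>m\<close> adds only a
  bounded error.\<close>

lemma iter_approx:
  assumes "e > 0"
  obtains c N where "\<And>n \<theta> x. n \<ge> N \<Longrightarrow> \<bar>iter n \<theta> x - x - real n * c\<bar> \<le> e * real n"
proof -
  obtain K where K: "K > 0" "\<And>n \<theta> x. \<bar>iter n \<theta> x - x\<bar> \<le> real n * K"
    using iter_bound by blast
  have e2: "e / 2 > 0" using assms by simp
  obtain M where M: "\<And>n \<theta> \<theta>' x x'. n \<ge> M \<Longrightarrow>
      \<bar>(iter n \<theta> x - x) - (iter n \<theta>' x' - x')\<bar> \<le> e / 2 * real n"
    using iter_oscillation[OF e2] by metis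
  define m where "m = Suc M"
  define d where "d = iter m 0 0"
  have blk: "\<bar>iter (k * m) \<theta> x - x - real k * d\<bar> \<le> real k * (e / 2 * real m)" for k \<theta> x
    by (rule iter_block) (use M[of m _ _ 0 0] in \<open>simp add: m_def d_def\<close>)
  \<comment> \<open>This makes two errors of size \<open>real m * K\<close>, from the incomplete
    block and from the matching part of \<open>real n * (d / real m)\<close>, at most half of
    \<open>e * n\<close>.\<close>
  obtain N :: nat where N: "4 * real m * K / e < real N" using reals_Archimedean2 by blast
  show ?thesis
  proof (rule that[of N "d / real m"])
    fix n \<theta> x assume "n \<ge> N"
    define k r where "k = n div m" and "r = n mod m"
    have n_eq: "n = k * m + r" by (simp add: k_def r_def)
    have "r < m" by (simp add: r_def m_def)
    have "iter n \<theta> x = iter r (rot (k * m) \<theta>) (iter (k * m) \<theta> x)"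
      by (subst n_eq) (rule fib_iterate_add)
    then have "\<bar>iter n \<theta> x - iter (k * m) \<theta> x\<bar> \<le> real r * K" using K(2) by simp
    also have "\<dots> \<le> real m * K" using K(1) \<open>r < m\<close> by simp
    finally have 1: "\<bar>iter n \<theta> x - iter (k * m) \<theta> x\<bar> \<le> real m * K" .
    have "\<bar>d\<bar> \<le> real m * K" using K(2)[of m 0 0] by (simp add: d_def)
    then have "real r * \<bar>d\<bar> \<le> real m * (real m * K)"
      using \<open>r < m\<close> by (intro mult_mono) auto
    then have "real r * (\<bar>d\<bar> / real m) \<le> real m * K"
      by (simp add: m_def field_simps)
    then have 2: "\<bar>real r * (d / real m)\<bar> \<le> real m * K" by (simp add: abs_mult)
    have 3: "real n * (d / real m) = real k * d + real r * (d / real m)"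
      by (simp add: n_eq m_def field_simps)
    have "real k * real m \<le> real n" using n_eq by (metis le_add1 of_nat_le_iff of_nat_mult)
    then have 4: "real k * (e / 2 * real m) \<le> e / 2 * real n"
      using assms by (simp add: field_simps)
    have "4 * real m * K / e \<le> real n" using N \<open>n \<ge> N\<close> by simp
    then have 5: "2 * (real m * K) \<le> e / 2 * real n" using assms by (simp add: field_simps)
    have triangle: "\<bar>u - x - (w + v)\<bar> \<le> 2 * H"
      if "\<bar>u - s\<bar> \<le> A" "\<bar>v\<bar> \<le> A" "t \<le> H" "2 * A \<le> H" "\<bar>s - x - w\<bar> \<le> t"
      for u s v w A H t :: real using that by linarith
    show "\<bar>iter n \<theta> x - x - real n * (d / real m)\<bar> \<le> e * real n"
      using triangle[OF 1 2 4 5 blk] unfolding 3 by simp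
  qed
qed

text \<open>The approximate rates \<open>c i\<close> with errors \<open>1 / (i + 1)\<close> form a
  Cauchy sequence, since any two of them describe the same iterate at a common large time.\<close>

lemma uniform_rotation_exists: "\<exists>r. uniform_rotation \<omega> E r"
proof -
  have "\<exists>c N. \<forall>n\<ge>N. \<forall>\<theta> x. \<bar>iter n \<theta> x - x - real n * c\<bar> \<le> inverse (real (Suc i)) * real n" for i
    using iter_approx[of "inverse (real (Suc i))"] by (metis inverse_positive_iff_positive of_nat_0_less_iff zero_less_Suc)
  then obtain c N where cN: "\<And>i n \<theta> x. n \<ge> N i \<Longrightarrow>
      \<bar>iter n \<theta> x - x - real n * c i\<bar> \<le> inverse (real (Suc i)) * real n" by metis
  have diff: "\<bar>c i - c j\<bar> \<le> inverse (real (Suc i)) + inverse (real (Suc j))" for i j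
  proof -
    define n where "n = Suc (N i + N j)"
    have "real n * \<bar>c i - c j\<bar> = \<bar>real n * c i - real n * c j\<bar>"
      by (simp add: abs_mult flip: right_diff_distrib)
    also have "\<dots> \<le> real n * (inverse (real (Suc i)) + inverse (real (Suc j)))"
      using cN[of i n 0 0] cN[of j n 0 0] by (simp add: n_def algebra_simps abs_le_iff)
    finally show ?thesis by (simp add: n_def)
  qed
  have lim0: "(\<lambda>i. inverse (real (Suc i))) \<longlonglongrightarrow> 0" by (rule LIMSEQ_inverse_real_of_nat)
  have "Cauchy c"
  proof (rule metric_CauchyI)
    fix e :: real assume "e > 0"
    then obtain n where n: "inverse (real (Suc n)) < e / 2" using reals_Archimedean[of "e / 2"] by auto
    have small: "inverse (real (Suc i)) < e / 2" if "i \<ge> n" for i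
    proof -
      have "inverse (real (Suc i)) \<le> inverse (real (Suc n))" using that by (simp add: field_simps)
      with n show ?thesis by linarith
    qed
    show "\<exists>M. \<forall>i\<ge>M. \<forall>j\<ge>M. dist (c i) (c j) < e"
    proof (intro exI allI impI)
      fix i j assume "n \<le> i" "n \<le> j"
      from small[OF this(1)] small[OF this(2)] diff[of i j] show "dist (c i) (c j) < e"
        by (simp add: dist_real_def)
    qed
  qed
  then obtain r where r: "c \<longlonglongrightarrow> r" using Cauchy_convergent_iff convergent_def by blast
  have cr: "\<bar>c i - r\<bar> \<le> inverse (real (Suc i))" for i
  proof (rule LIMSEQ_le)
    show "(\<lambda>j. \<bar>c i - c j\<bar>) \<longlonglongrightarrow> \<bar>c i - r\<bar>" using r by (intro tendsto_intros)
    show "(\<lambda>j. inverse (real (Suc i)) + inverse (real (Suc j))) \<longlonglongrightarrow> inverse (real (Suc i))"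
      using tendsto_add[OF tendsto_const lim0] by simp
  qed (use diff in blast)
  have "uniform_rotation \<omega> E r"
    unfolding uniform_rotation_def
  proof (intro allI impI)
    fix e :: real assume "e > 0"
    then obtain i where i: "inverse (real (Suc i)) < e / 2" using reals_Archimedean[of "e / 2"] by auto
    show "\<exists>N. \<forall>n\<ge>N. \<forall>\<theta> x. \<bar>iter n \<theta> x - x - real n * r\<bar> \<le> e * real n"
    proof (intro exI allI impI)
      fix n \<theta> x assume "n \<ge> N i"
      have triangle: "\<bar>a - p\<bar> \<le> s" if "2 * \<bar>q - p\<bar> \<le> s" "2 * t \<le> s" "\<bar>a - q\<bar> \<le> t"
        for a p q s t :: real using that by (smt (verit))
      have "\<bar>real n * c i - real n * r\<bar> = real n * \<bar>c i - r\<bar>"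
        by (simp add: abs_mult flip: right_diff_distrib)
      also have "\<dots> \<le> real n * (e / 2)" using cr[of i] i by (intro mult_left_mono) auto
      finally have "2 * \<bar>real n * c i - real n * r\<bar> \<le> e * real n" by (simp add: mult.commute)
      moreover have "inverse (real (Suc i)) * real n \<le> e / 2 * real n" using i by (intro mult_right_mono) auto
      then have "2 * (inverse (real (Suc i)) * real n) \<le> e * real n" by simp
      ultimately show "\<bar>iter n \<theta> x - x - real n * r\<bar> \<le> e * real n"
        using triangle cN[OF \<open>n \<ge> N i\<close>, of \<theta> x] by blast
    qed
  qed
  then show ?thesis ..
qed

text \<open>Repeating one estimate at time \<open>m\<close> in blocks reaches arbitrarily large
  times, so finite time data control the rotation number. This will give its continuity.\<close>

lemma uniform_rotation_close:
  assumes r: "uniform_rotation \<omega> E r" and m: "m > 0"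
    and close: "\<And>\<theta> x. \<bar>iter m \<theta> x - x - real m * c\<bar> \<le> real m * \<eta>"
  shows "\<bar>r - c\<bar> \<le> \<eta>"
proof (rule field_le_epsilon)
  fix e :: real assume "e > 0"
  then obtain N where N: "\<And>n \<theta> x. n \<ge> N \<Longrightarrow> \<bar>iter n \<theta> x - x - real n * r\<bar> \<le> e * real n"
    using r unfolding uniform_rotation_def by metis
  define k where "k = Suc N"
  have "Suc N * 1 \<le> Suc N * m" using m by (intro mult_le_mono2) simp
  then have "Suc N \<le> Suc N * m" by (simp only: mult_1_right)
  then have "N \<le> k * m" unfolding k_def by (rule Suc_leD)
  from N[OF this, of 0 0] iter_block[OF close, of k 0 0]
  have "\<bar>real k * (real m * c) - real (k * m) * r\<bar> \<le> real k * (real m * \<eta>) + e * real (k * m)"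
    by simp
  moreover have "real k * (real m * c) - real (k * m) * r = real (k * m) * (c - r)"
    by (simp add: algebra_simps)
  moreover have "real k * (real m * \<eta>) + e * real (k * m) = real (k * m) * (\<eta> + e)"
    by (simp add: algebra_simps)
  ultimately have "\<bar>real (k * m) * (c - r)\<bar> \<le> real (k * m) * (\<eta> + e)" by simp
  then have "real (k * m) * \<bar>r - c\<bar> \<le> real (k * m) * (\<eta> + e)"
    by (simp only: abs_mult abs_of_nat abs_minus_commute[of c r])
  moreover have "real (k * m) > 0" using m unfolding k_def by (simp del: of_nat_mult)
  ultimately show "\<bar>r - c\<bar> \<le> \<eta> + e" by (simp only: mult_le_cancel_left_pos)
qed

text \<open>Monotonicity of \<open>E\<close> passes the induction hypothesis through the next step;
  \<open>G\<close> is general so that it may be the non-monotone Arnold fibre map.\<close>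

lemma iter_le:
  assumes "\<And>\<theta> x. G \<theta> x \<le> E \<theta> x"
  shows "fib_iterate \<omega> G n \<theta> x \<le> iter n \<theta> x"
proof (induction n)
  case (Suc n)
  have "fib_iterate \<omega> G (Suc n) \<theta> x \<le> E (rot n \<theta>) (fib_iterate \<omega> G n \<theta> x)" using assms by simp
  also have "\<dots> \<le> iter (Suc n) \<theta> x" using mono[OF Suc] by simp
  finally show ?case .
qed simp

lemma iter_ge:
  assumes "\<And>\<theta> x. E \<theta> x \<le> G \<theta> x"
  shows "iter n \<theta> x \<le> fib_iterate \<omega> G n \<theta> x"
proof (induction n)
  case (Suc n)
  have "iter (Suc n) \<theta> x \<le> E (rot n \<theta>) (fib_iterate \<omega> G n \<theta> x)" using mono[OF Suc] by simp
  also have "\<dots> \<le> fib_iterate \<omega> G (Suc n) \<theta> x" using assms by simp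
  finally show ?case .
qed simp

end

section \<open>Minimal sets of extensions of an irrational rotation\<close>

lemma minimal_set_exists:
  fixes f :: "'a::t2_space \<Rightarrow> 'a"
  assumes "compact A" "A \<noteq> {}" "f ` A \<subseteq> A"
  obtains M where "M \<subseteq> A" "minimal_set f M"
proof -
  define S where "S = {X. X \<subseteq> A \<and> X \<noteq> {} \<and> closed X \<and> f ` X \<subseteq> X}"
  \<comment> \<open>Zorn's lemma yields maximal elements, so it is applied to complements: unions of
    chains there are intersections of nested sets here.\<close>
  have "\<exists>Y\<in>uminus ` S. \<forall>Z\<in>uminus ` S. Y \<subseteq> Z \<longrightarrow> Z = Y"
  proof (rule subset_Zorn_nonempty)
    have "A \<in> S" using assms by (simp add: S_def compact_imp_closed)
    then show "uminus ` S \<noteq> {}" by blast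
    fix \<C> assume ne: "\<C> \<noteq> {}" and ch: "subset.chain (uminus ` S) \<C>"
    define \<D> where "\<D> = uminus ` \<C>"
    have "\<C> \<subseteq> uminus ` S" using ch by (simp add: subset.chain_def)
    then have "\<D> \<subseteq> uminus ` uminus ` S" unfolding \<D>_def by (rule image_mono)
    then have sub: "\<D> \<subseteq> S" by (simp add: image_image)
    have cmp: "X \<subseteq> Y \<or> Y \<subseteq> X" if XY: "X \<in> \<D>" "Y \<in> \<D>" for X Y
    proof -
      obtain X' Y' where "X = - X'" "Y = - Y'" "X' \<in> \<C>" "Y' \<in> \<C>" using XY unfolding \<D>_def by blast
      moreover from this have "X' \<subseteq> Y' \<or> Y' \<subseteq> X'" using ch unfolding subset_chain_def by blast
      ultimately show ?thesis by blast
    qed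
    \<comment> \<open>A non-empty finite part of the chain has a least member, which is a non-empty
      subset of \<open>A\<close>; so the finite intersection property applies.\<close>
    have "A \<inter> \<Inter>\<D> \<noteq> {}"
    proof (rule compact_imp_fip[OF assms(1)])
      show "closed T" if "T \<in> \<D>" for T using that sub by (auto simp: S_def)
      fix F assume F: "finite F" "F \<subseteq> \<D>"
      show "A \<inter> \<Inter>F \<noteq> {}"
      proof (cases "F = {}")
        case False
        then obtain X where X: "X \<in> F" "\<forall>Y\<in>F. Y \<subseteq> X \<longrightarrow> X = Y"
          using finite_has_minimal[OF F(1)] by blast
        have "X \<subseteq> Y" if "Y \<in> F" for Y
        proof -
          have "X \<subseteq> Y \<or> Y \<subseteq> X" using that X(1) F(2) by (intro cmp) auto
          then show ?thesis using X(2) that by blast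
        qed
        then have "X \<subseteq> \<Inter>F" by blast
        moreover have "X \<in> S" using X(1) F(2) sub by blast
        then have "X \<subseteq> A" "X \<noteq> {}" by (simp_all add: S_def)
        ultimately show ?thesis by blast
      next
        case True
        then show ?thesis using assms(2) by simp
      qed
    qed
    moreover have "\<D> \<noteq> {}" using ne by (simp add: \<D>_def)
    moreover have "f ` \<Inter>\<D> \<subseteq> \<Inter>\<D>"
    proof -
      have "f ` X \<subseteq> X" if "X \<in> \<D>" for X
      proof -
        have "X \<in> S" using sub that by blast
        then show ?thesis by (simp add: S_def)
      qed
      then show ?thesis by blast
    qed
    moreover have cl: "closed X" "X \<subseteq> A" if "X \<in> \<D>" for X
    proof -
      have "X \<in> S" using sub that by blast
      then show "closed X" "X \<subseteq> A" by (simp_all add: S_def)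
    qed
    have "closed (\<Inter>\<D>)" using cl(1) by (intro closed_Inter) blast
    moreover have "\<Inter>\<D> \<subseteq> A" using cl(2) \<open>\<D> \<noteq> {}\<close> by blast
    ultimately have "\<Inter>\<D> \<in> S" unfolding S_def by blast
    moreover have "\<Union>\<C> = - \<Inter>\<D>" by (auto simp: \<D>_def)
    ultimately show "\<Union>\<C> \<in> uminus ` S" by blast
  qed
  then obtain M where M: "M \<in> S" "\<And>Z. Z \<in> S \<Longrightarrow> Z \<subseteq> M \<Longrightarrow> Z = M"
  proof -
    assume *: "\<And>M. M \<in> S \<Longrightarrow> (\<And>Z. Z \<in> S \<Longrightarrow> Z \<subseteq> M \<Longrightarrow> Z = M) \<Longrightarrow> thesis"
    from \<open>\<exists>Y\<in>uminus ` S. \<forall>Z\<in>uminus ` S. Y \<subseteq> Z \<longrightarrow> Z = Y\<close> obtain M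
      where M: "M \<in> S" "\<forall>Z\<in>uminus ` S. - M \<subseteq> Z \<longrightarrow> Z = - M" by blast
    show thesis
    proof (rule *[OF M(1)])
      fix Z assume "Z \<in> S" "Z \<subseteq> M"
      then have "- Z = - M" using M(2) by blast
      then show "Z = M" by simp
    qed
  qed
  show ?thesis
  proof (rule that)
    show "M \<subseteq> A" using M by (simp add: S_def)
    show "minimal_set f M"
      unfolding minimal_set_def
    proof (intro conjI notI)
      assume "\<exists>K. K \<subset> M \<and> K \<noteq> {} \<and> closed K \<and> f ` K \<subseteq> K"
      then obtain K where K: "K \<subset> M" "K \<noteq> {}" "closed K" "f ` K \<subseteq> K" by blast
      moreover have "M \<subseteq> A" using M by (simp add: S_def)
      ultimately have "K \<in> S" by (auto simp: S_def)
      then show False using M(2)[of K] K(1) by blast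
    qed (use M(1) in \<open>auto simp: S_def\<close>)
  qed
qed

lemma continuous_on_funpow:
  fixes f :: "'a::topological_space \<Rightarrow> 'a"
  assumes "continuous_on UNIV f"
  shows "continuous_on UNIV (f ^^ n)"
proof (induction n)
  case (Suc n)
  have "continuous_on UNIV (f \<circ> f ^^ n)"
    by (rule continuous_on_compose[OF Suc continuous_on_subset[OF assms]]) simp
  then show ?case by (simp only: funpow.simps)
qed (simp add: continuous_on_id)

lemma minimal_set_invariant: "minimal_set f M \<Longrightarrow> z \<in> M \<Longrightarrow> (f ^^ n) z \<in> M"
  by (induction n) (auto simp: minimal_set_def)

lemma minimal_set_eq:
  "minimal_set f M \<Longrightarrow> K \<subseteq> M \<Longrightarrow> K \<noteq> {} \<Longrightarrow> closed K \<Longrightarrow> f ` K \<subseteq> K \<Longrightarrow> K = M"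
  unfolding minimal_set_def by blast

text \<open>The points of \<open>M\<close> that never visit \<open>U\<close> form a closed invariant
  set; it is a proper subset, hence empty, and compactness bounds the visiting times.\<close>

lemma minimal_set_returns:
  fixes f :: "'a::t2_space \<Rightarrow> 'a"
  assumes min: "minimal_set f M" and M: "compact M" and f: "continuous_on UNIV f"
    and U: "open U" "U \<inter> M \<noteq> {}"
  obtains N where "\<And>z. z \<in> M \<Longrightarrow> \<exists>n\<le>N. (f ^^ n) z \<in> U"
proof -
  define V where "V n = (f ^^ n) -` U" for n
  have V: "open (V n)" for n
    unfolding V_def by (rule open_vimage[OF U(1) continuous_on_funpow[OF f]])
  have "M \<subseteq> (\<Union>n. V n)"
  proof (rule ccontr)
    assume "\<not> M \<subseteq> (\<Union>n. V n)"
    moreover have "f z \<notin> V n" if "z \<notin> (\<Union>n. V n)" for z n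
    proof -
      have "z \<notin> V (Suc n)" using that by blast
      then show ?thesis by (simp add: V_def funpow_swap1)
    qed
    then have "f ` (M - (\<Union>n. V n)) \<subseteq> M - (\<Union>n. V n)"
      using min by (auto simp: minimal_set_def)
    moreover have "closed (M - (\<Union>n. V n))"
      using V M by (intro closed_Diff compact_imp_closed open_UN) auto
    ultimately have "M - (\<Union>n. V n) = M" by (intro minimal_set_eq[OF min]) auto
    moreover have "U \<subseteq> V 0" by (simp add: V_def)
    ultimately show False using U(2) by blast
  qed
  then obtain T where T: "finite T" "M \<subseteq> (\<Union>n\<in>T. V n)"
    using compactE_image[OF M, of UNIV V] V by metis
  show ?thesis
  proof (rule that[of "Max (insert 0 T)"])
    fix z assume "z \<in> M"
    then obtain n where n: "n \<in> T" "z \<in> V n" using T by blast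
    then have "n \<le> Max (insert 0 T)" using T(1) by (intro Max_ge) auto
    then show "\<exists>n\<le>Max (insert 0 T). (f ^^ n) z \<in> U" using n by (auto simp: V_def)
  qed
qed

section \<open>Arcs, translates and interiors on the circle\<close>

lemma open_circle_of_interval: "open (circle_of ` {a<..<b})"
  unfolding open_circle_iff
proof -
  have "circle_of -` circle_of ` {a<..<b} = (\<Union>k::int. {a + of_int k<..<b + of_int k})"
  proof (intro equalityI subsetI)
    fix x assume "x \<in> circle_of -` circle_of ` {a<..<b}"
    then obtain y where y: "y \<in> {a<..<b}" "x - y \<in> \<int>" by (auto simp: circle_of_eq_iff)
    then obtain k where "x - y = of_int k" by (auto elim: Ints_cases)
    then show "x \<in> (\<Union>k::int. {a + of_int k<..<b + of_int k})"
      using y(1) by (intro UN_I[of k]) auto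
  next
    fix x assume "x \<in> (\<Union>k::int. {a + of_int k<..<b + of_int k})"
    then obtain k :: int where "x \<in> {a + of_int k<..<b + of_int k}" by blast
    then have "x - of_int k \<in> {a<..<b}" by auto
    moreover have "circle_of x = circle_of (x - of_int k)" by (simp add: circle_of_eq_iff)
    ultimately show "x \<in> circle_of -` circle_of ` {a<..<b}" by blast
  qed
  then show "open (circle_of -` circle_of ` {a<..<b})" by auto
qed

lemma connected_UNIV_circle: "connected (UNIV :: circle set)"
proof -
  have "(UNIV :: circle set) = range circle_of" using circle_of_surj by blast
  then show ?thesis
    using connected_continuous_image[OF continuous_on_circle_of connected_UNIV] by simp
qed

text \<open>Otherwise \<open>S\<close> misses a point on each of the two arcs between
  \<open>a\<close> and \<open>b\<close>, and these two points cut the circle into disjoint open arcs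
  around \<open>b\<close> and \<open>a\<close>.\<close>

lemma connected_circle_interior:
  assumes S: "connected S" and ab: "a \<in> S" "b \<in> S" "a \<noteq> (b :: circle)"
  shows "interior S \<noteq> {}"
proof
  assume int: "interior S = {}"
  have gap: "\<exists>r\<in>{s<..<t}. circle_of r \<notin> S" if "s < t" for s t
  proof (rule ccontr)
    assume "\<not> ?thesis"
    then have "circle_of ` {s<..<t} \<subseteq> interior S"
      by (intro interior_maximal open_circle_of_interval) auto
    moreover have "circle_of ((s + t) / 2) \<in> circle_of ` {s<..<t}" using that by auto
    ultimately show False using int by blast
  qed
  obtain x y0 where x: "a = circle_of x" and y0: "b = circle_of y0" using circle_of_surj by metis
  define y where "y = x + frac (y0 - x)"
  have y: "b = circle_of y" unfolding y0 y_def circle_of_eq_iff by (simp add: frac_def)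
  have "frac (y0 - x) \<noteq> 0"
    using ab(3) unfolding x y0 circle_of_eq_iff by (metis Ints_minus frac_eq_0_iff minus_diff_eq)
  then have xy: "x < y" "y < x + 1"
    using frac_ge_0[of "y0 - x"] frac_lt_1[of "y0 - x"] by (simp_all add: y_def)
  obtain p where p: "x < p" "p < y" "circle_of p \<notin> S" using gap[OF xy(1)] by auto
  obtain q where q: "y < q" "q < x + 1" "circle_of q \<notin> S" using gap[OF xy(2)] by auto
  have 1: "b \<in> circle_of ` {p<..<q}" using p q y by auto
  have 2: "a \<in> circle_of ` {q<..<p + 1}"
    using p q x circle_of_of_int_add[of x 1] by (intro image_eqI[of _ _ "x + 1"]) auto
  have 3: "circle_of ` {p<..<q} \<inter> circle_of ` {q<..<p + 1} = {}"
  proof -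
    have False if uv: "circle_of u = circle_of v" "p < u" "u < q" "q < v" "v < p + 1" for u v
    proof -
      from uv(1) obtain k where k: "v - u = of_int k"
        by (metis circle_of_eq_iff Ints_cases)
      then have "0 < real_of_int k" "real_of_int k < 1" using uv by linarith+
      then show False by simp
    qed
    then show ?thesis by force
  qed
  have 4: "S \<subseteq> circle_of ` {p<..<q} \<union> circle_of ` {q<..<p + 1}"
  proof
    fix c assume "c \<in> S"
    obtain z where z: "c = circle_of z" using circle_of_surj by blast
    define w where "w = p + frac (z - p)"
    have w: "c = circle_of w" unfolding z w_def circle_of_eq_iff by (simp add: frac_def)
    have "w \<ge> p" "w < p + 1" using frac_lt_1[of "z - p"] by (simp_all add: w_def)
    moreover have "w \<noteq> p" "w \<noteq> q" using \<open>c \<in> S\<close> w p q by auto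
    ultimately have "w \<in> {p<..<q} \<or> w \<in> {q<..<p + 1}" by auto
    then show "c \<in> circle_of ` {p<..<q} \<union> circle_of ` {q<..<p + 1}" using w by blast
  qed
  show False
    using connectedD[OF S open_circle_of_interval open_circle_of_interval, of p q q "p + 1"] 1 2 3 4 ab
    by blast
qed

lemma continuous_circle_translate: "continuous_on S (\<lambda>\<theta>. \<theta> + (c :: circle))"
  unfolding continuous_on_iff by (auto simp: dist_circle_add)

lemma interior_circle_translate:
  assumes "interior S = {}"
  shows "interior ((\<lambda>\<theta>. \<theta> + (c :: circle)) -` S) = {}"
proof (rule ccontr)
  let ?T = "interior ((\<lambda>\<theta>. \<theta> + c) -` S)"
  assume "?T \<noteq> {}"
  then obtain t where t: "t \<in> ?T" by blast
  have "open ((\<lambda>\<theta>. \<theta> + - c) -` ?T)"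
    by (rule open_vimage[OF open_interior continuous_circle_translate])
  moreover have "(\<lambda>\<theta>. \<theta> + - c) -` ?T \<subseteq> S"
  proof
    fix \<theta> assume "\<theta> \<in> (\<lambda>\<theta>. \<theta> + - c) -` ?T"
    then have "\<theta> + - c \<in> (\<lambda>\<theta>. \<theta> + c) -` S" using interior_subset by blast
    then show "\<theta> \<in> S" by simp
  qed
  ultimately have "(\<lambda>\<theta>. \<theta> + - c) -` ?T \<subseteq> interior S" by (rule interior_maximal[rotated])
  moreover have "t + c \<in> (\<lambda>\<theta>. \<theta> + - c) -` ?T" using t by simp
  ultimately show False using assms by blast
qed

lemma interior_finite_UN_empty:
  assumes "finite I" "\<And>i. i \<in> I \<Longrightarrow> closed (S i)" "\<And>i. i \<in> I \<Longrightarrow> interior (S i) = {}"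
  shows "interior (\<Union>i\<in>I. S i) = {}"
  using assms
proof (induction I)
  case (insert i I)
  have "interior ((\<Union>i\<in>I. S i) \<union> S i) = interior (\<Union>i\<in>I. S i)"
    using insert by (intro interior_closed_Un_empty_interior) auto
  then show ?case using insert by (simp add: Un_commute)
qed simp

lemma circle_open_contains_interval:
  assumes "open U" "U \<noteq> {}"
  shows "\<exists>I. circle_open_interval I \<and> I \<subseteq> U"
proof -
  obtain c where "c \<in> U" using assms(2) by blast
  then obtain x where x: "circle_of x \<in> U" using circle_of_surj by metis
  then obtain e where e: "e > 0" "ball x e \<subseteq> circle_of -` U"
    using assms(1) unfolding open_circle_iff by (meson open_contains_ball vimageI)
  then have "circle_of ` {x - e<..<x + e} \<subseteq> U" by (auto simp: ball_eq_greaterThanLessThan)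
  moreover have "circle_open_interval (circle_of ` {x - e<..<x + e})"
    unfolding circle_open_interval_def using e(1) by (intro exI conjI) auto
  ultimately show ?thesis by blast
qed

section \<open>Projections and components of a minimal set\<close>

locale minimal_rotation_extension =
  fixes \<omega> :: circle and f :: "circle \<times> circle \<Rightarrow> circle \<times> circle" and M :: "(circle \<times> circle) set"
  assumes irrational: "\<omega> \<notin> circle_of ` \<rat>"
    and continuous: "continuous_on UNIV f"
    and fst_f: "fst (f z) = fst z + \<omega>"
    and compact: "compact M"
    and minimal: "minimal_set f M"
begin

lemma fst_funpow: "fst ((f ^^ n) z) = ((\<lambda>\<theta>. \<theta> + \<omega>) ^^ n) (fst z)"
  by (induction n) (simp_all add: fst_f)

text \<open>The projection is closed and contains a whole forward orbit of the rotation, which is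
  dense.\<close>

lemma fst_image: "fst ` M = UNIV"
proof -
  have "closed (fst ` M)"
    by (intro compact_imp_closed compact_continuous_image compact continuous_on_fst continuous_on_id)
  moreover have "\<exists>\<theta>'\<in>fst ` M. dist \<theta>' \<theta> < e" if "e > 0" for \<theta> e
  proof -
    obtain z where z: "z \<in> M" using minimal by (auto simp: minimal_set_def)
    obtain j where "dist (((\<lambda>\<theta>. \<theta> + \<omega>) ^^ j) (fst z)) \<theta> < e"
      using irrational_rotation_dense[OF irrational \<open>e > 0\<close>] by metis
    then show ?thesis
      using minimal_set_invariant[OF minimal z, of j] fst_funpow[of j z] by (metis imageI)
  qed
  ultimately show ?thesis
    by (metis UNIV_eq_I closed_approachable)
qed

text \<open>By the bounded return times, finitely many rotated copies of the closed set
  \<open>S\<close> cover the circle, so \<open>S\<close> has interior.\<close>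

lemma projection_contains_interval:
  assumes z: "z \<in> M" and U: "open U" "z \<in> U"
  shows "\<exists>I. circle_open_interval I \<and> I \<subseteq> fst ` (U \<inter> M)"
proof -
  obtain r where r: "r > 0" "cball z r \<subseteq> U" using U by (meson open_contains_cball)
  \<comment> \<open>The closed ball makes \<open>S\<close> closed; the returns are taken to the open
    ball of the same radius.\<close>
  define S where "S = fst ` (cball z r \<inter> M)"
  have S: "closed S"
    unfolding S_def using compact
    by (intro compact_imp_closed compact_continuous_image continuous_on_fst continuous_on_id
        closed_Int_compact closed_cball)
  obtain N where N: "\<And>y. y \<in> M \<Longrightarrow> \<exists>n\<le>N. (f ^^ n) y \<in> ball z r"
    using minimal_set_returns[OF minimal compact continuous, of "ball z r"] z r(1)
    by (metis IntI centre_in_ball empty_iff open_ball)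
  have "(\<Union>n\<le>N. ((\<lambda>\<theta>. \<theta> + ((\<lambda>\<theta>. \<theta> + \<omega>) ^^ n) 0) -` S)) = UNIV"
  proof (intro UNIV_eq_I[symmetric])
    fix \<theta>
    obtain y where y: "y \<in> M" "\<theta> = fst y" using fst_image by (metis UNIV_I imageE)
    then obtain n where n: "n \<le> N" "(f ^^ n) y \<in> ball z r" using N by blast
    then have "fst ((f ^^ n) y) \<in> S"
      using minimal_set_invariant[OF minimal y(1), of n] unfolding S_def by auto
    then show "\<theta> \<in> (\<Union>n\<le>N. ((\<lambda>\<theta>. \<theta> + ((\<lambda>\<theta>. \<theta> + \<omega>) ^^ n) 0) -` S))"
      using n(1) y(2) fst_funpow[of n y] funpow_rotation[of n \<omega> \<theta>] by auto
  qed
  moreover have "interior (\<Union>n\<le>N. ((\<lambda>\<theta>. \<theta> + ((\<lambda>\<theta>. \<theta> + \<omega>) ^^ n) 0) -` S)) = {}" if "interior S = {}"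
    using that S
    by (intro interior_finite_UN_empty interior_circle_translate closed_vimage continuous_circle_translate) auto
  ultimately have "interior S \<noteq> {}" by auto
  then obtain I where I: "circle_open_interval I" "I \<subseteq> interior S"
    using circle_open_contains_interval[OF open_interior] by metis
  moreover have "interior S \<subseteq> fst ` (U \<inter> M)" using interior_subset r(2) unfolding S_def by blast
  ultimately show ?thesis by blast
qed

text \<open>The base radius \<open>e\<close> is the same for all points; this yields a closed
  invariant set, which by minimality is empty or all of \<open>M\<close>.\<close>

definition wide :: "real \<Rightarrow> (circle \<times> circle) set" where
  "wide e = {z \<in> M. ball (fst z) e \<subseteq> fst ` connected_component_set M z}"

text \<open>Components of a compact set are upper semicontinuous: if the component of the limit
  missed the fibre over \<theta>, a relatively clopen set would separate the two, and it would
  contain the components of the nearby \<open>z n\<close>.\<close>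

lemma closed_wide: "closed (wide e)"
  unfolding closed_sequential_limits
proof (intro allI impI, elim conjE)
  fix z l assume z: "\<forall>n. z n \<in> wide e" and lim: "z \<longlonglongrightarrow> l"
  have zM: "z n \<in> M" for n using z by (simp add: wide_def)
  have l: "l \<in> M" using compact_imp_closed[OF compact] lim zM closed_sequentially by blast
  have "\<theta> \<in> fst ` connected_component_set M l" if \<theta>: "\<theta> \<in> ball (fst l) e" for \<theta>
  proof (rule ccontr)
    assume not: "\<theta> \<notin> fst ` connected_component_set M l"
    let ?X = "top_of_set M"
    define Q where "Q = connected_component_set M l"
    define K where "K = M \<inter> fst -` {\<theta>}"
    have "connected_component_of_set ?X l = Q"
      using l unfolding Q_def connected_component_of_def connected_component_def
      by (auto simp: connectedin_subtopology connectedin_iff_connected)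
    moreover have "compact_space ?X" "Hausdorff_space ?X"
      using compact by (simp_all add: compact_space_subtopology compactin_euclidean_iff Hausdorff_space_subtopology)
    \<comment> \<open>In compact Hausdorff spaces components are quasi-components, which can be
      separated from disjoint compact sets.\<close>
    ultimately have "Q \<in> quasi_components_of ?X"
      using l quasi_eq_connected_components_of[of ?X] unfolding connected_components_of_def by auto
    moreover have "closed (fst -` {\<theta>} :: (circle \<times> circle) set)"
      by (intro closed_vimage continuous_on_fst continuous_on_id) auto
    then have "compactin ?X K"
      using compact by (auto simp: K_def compactin_subtopology compactin_euclidean_iff compact_Int_closed)
    moreover have "disjnt Q K" using not by (auto simp: disjnt_def Q_def K_def)
    ultimately have "separated_between ?X Q K"
      by (simp add: separated_between_quasi_component_compact)
    then obtain U V where UV: "openin ?X U" "openin ?X V" "U \<union> V = M" "U \<inter> V = {}" "Q \<subseteq> U" "K \<subseteq> V"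
      unfolding separated_between_def disjnt_def by auto
    have "l \<in> U" using UV(5) l by (auto simp: Q_def)
    obtain W where W: "open W" "U = M \<inter> W" using UV(1) by (auto simp: openin_open)
    have "\<forall>\<^sub>F n in sequentially. z n \<in> W"
      using topological_tendstoD[OF lim W(1)] \<open>l \<in> U\<close> W(2) by blast
    \<comment> \<open>The ball around \<open>fst l\<close> is open, so \<theta> also lies in the
      balls of radius \<open>e\<close> around \<open>fst (z n)\<close> for large
      \<open>n\<close>.\<close>
    moreover have "\<forall>\<^sub>F n in sequentially. fst (z n) \<in> ball \<theta> e"
      using topological_tendstoD[OF tendsto_fst[OF lim], of "ball \<theta> e"] \<theta> by (simp add: dist_commute)
    ultimately obtain n where n: "z n \<in> W" "fst (z n) \<in> ball \<theta> e"
      using eventually_happens[OF eventually_conj] by fastforce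
    have "\<theta> \<in> fst ` connected_component_set M (z n)"
    proof -
      have "ball (fst (z n)) e \<subseteq> fst ` connected_component_set M (z n)" using z by (simp add: wide_def)
      moreover have "\<theta> \<in> ball (fst (z n)) e" using n(2) by (simp add: dist_commute)
      ultimately show ?thesis by blast
    qed
    then obtain w where w: "w \<in> connected_component_set M (z n)" "fst w = \<theta>" by blast
    then have "w \<in> M" using connected_component_subset by blast
    then have "w \<in> V" using w(2) UV(6) by (auto simp: K_def)
    moreover have "z n \<in> U" using n(1) zM W(2) by blast
    moreover have "connected (connected_component_set M (z n))" by simp
    moreover have "connected_component_set M (z n) \<subseteq> U \<union> V"
      using connected_component_subset UV(3) by blast
    moreover have "z n \<in> connected_component_set M (z n)" using zM by simp
    moreover obtain W' where W': "open W'" "V = M \<inter> W'" using UV(2) by (auto simp: openin_open)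
    ultimately show False
      using connectedD[of "connected_component_set M (z n)" W W'] W w(1) UV(4)
        connected_component_subset[of M "z n"] by blast
  qed
  then show "l \<in> wide e" using l by (auto simp: wide_def)
qed

text \<open>\<open>f\<close> maps the component of \<open>z\<close> into that of \<open>f z\<close>
  and shifts its projection isometrically by \<omega>.\<close>

lemma wide_invariant: "f ` wide e \<subseteq> wide e"
proof
  fix y assume "y \<in> f ` wide e"
  then obtain z where z: "z \<in> wide e" "y = f z" by blast
  have zM: "z \<in> M" using z(1) by (simp add: wide_def)
  have inv: "f ` M \<subseteq> M" using minimal by (simp add: minimal_set_def)
  have sub: "f ` connected_component_set M z \<subseteq> connected_component_set M (f z)"
  proof (rule connected_component_maximal)
    show "f z \<in> f ` connected_component_set M z" using zM by auto
    show "connected (f ` connected_component_set M z)"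
      by (rule connected_continuous_image[OF continuous_on_subset[OF continuous]]) auto
    show "f ` connected_component_set M z \<subseteq> M" using inv connected_component_subset by blast
  qed
  have "\<theta> \<in> fst ` connected_component_set M y" if "\<theta> \<in> ball (fst y) e" for \<theta>
  proof -
    have "dist (fst z + \<omega>) (\<theta> - \<omega> + \<omega>) < e" using that z(2) by (simp add: fst_f)
    then have "\<theta> - \<omega> \<in> ball (fst z) e" unfolding dist_circle_add by simp
    then obtain w where w: "w \<in> connected_component_set M z" "fst w = \<theta> - \<omega>"
      using z(1) by (auto simp: wide_def)
    then have "fst (f w) = \<theta>" by (simp add: fst_f)
    then show ?thesis using sub w(1) z(2) by blast
  qed
  then show "y \<in> wide e" using zM inv z(2) by (auto simp: wide_def)
qed

text \<open>By minimality, one component with non-degenerate projection forces a uniform lower bound on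
  the extent of all components, so that they project onto the whole circle.\<close>

lemma component_projection:
  assumes C: "C \<in> components M" and nonsing: "\<nexists>\<theta>. fst ` C = {\<theta>}"
  obtains D where "connected D" "D \<subseteq> M" "fst ` D = UNIV"
proof -
  have Cc: "connected C" "C \<noteq> {}" "C \<subseteq> M"
    using C in_components_connected in_components_nonempty in_components_subset by blast+
  have conn: "connected (fst ` C)"
    by (intro connected_continuous_image continuous_on_fst continuous_on_id Cc)
  obtain a where a: "a \<in> fst ` C" using Cc(2) by blast
  have "\<exists>b\<in>S. a \<noteq> b" if "a \<in> S" "S \<noteq> {a}" for S using that by auto
  from this[OF a] nonsing obtain b where b: "b \<in> fst ` C" "a \<noteq> b" by metis
  have "interior (fst ` C) \<noteq> {}" by (rule connected_circle_interior[OF conn a b])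
  then obtain \<theta> e where \<theta>: "e > 0" "ball \<theta> e \<subseteq> fst ` C"
    using mem_interior by blast
  have "\<theta> \<in> fst ` C" using \<theta>(1) by (intro subsetD[OF \<theta>(2)]) simp
  then obtain z where "z \<in> C" "\<theta> = fst z" by (elim imageE)
  with \<theta> have z: "z \<in> C" "e > 0" "ball (fst z) e \<subseteq> fst ` C" by simp_all
  have "C = connected_component_set M z"
    using C z(1) by (metis components_iff connected_component_eq)
  then have "z \<in> wide e" using z Cc(3) by (auto simp: wide_def)
  then have "wide e \<noteq> {}" by blast
  then have "wide e = M"
    by (intro minimal_set_eq[OF minimal _ _ closed_wide wide_invariant]) (simp_all add: wide_def)
  define D where "D = connected_component_set M z"
  have DM: "D \<subseteq> M" unfolding D_def by (rule connected_component_subset)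
  have balls: "ball \<theta> e \<subseteq> fst ` D" if \<theta>: "\<theta> \<in> fst ` D" for \<theta>
  proof -
    obtain w where w: "w \<in> D" "\<theta> = fst w" using \<theta> by blast
    then have "connected_component_set M w = D" unfolding D_def by (metis connected_component_eq)
    moreover have "w \<in> wide e" using w(1) DM \<open>wide e = M\<close> by blast
    ultimately show ?thesis using w(2) by (simp add: wide_def)
  qed
  \<comment> \<open>All points of the projection carry balls of the same radius \<open>e\<close>; by
    symmetry of the distance so do the points of the complement.\<close>
  have "open (fst ` D)" unfolding open_contains_ball using balls z(2) by blast
  moreover have "open (- (fst ` D))"
    unfolding open_contains_ball
  proof (intro ballI exI conjI)
    fix \<theta> assume \<theta>: "\<theta> \<in> - (fst ` D)"
    show "ball \<theta> e \<subseteq> - (fst ` D)"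
    proof
      fix \<theta>' assume "\<theta>' \<in> ball \<theta> e"
      then have "\<theta> \<in> ball \<theta>' e" by (simp add: dist_commute)
      then show "\<theta>' \<in> - (fst ` D)" using balls[of \<theta>'] \<theta> by blast
    qed
  qed (use z(2) in simp)
  moreover have "fst z \<in> fst ` D" using z Cc(3) by (auto simp: D_def)
  ultimately have "fst ` D = UNIV"
    using connectedD[OF connected_UNIV_circle, of "fst ` D" "- (fst ` D)"] by blast
  then show ?thesis using that[of D] DM by (simp add: D_def)
qed

end

section \<open>Vanishing entropy of monotone extensions\<close>

definition unit_rep :: "circle \<Rightarrow> real" where
  "unit_rep c = frac (SOME x. c = circle_of x)"

lemma unit_rep: "circle_of (unit_rep c) = c" "0 \<le> unit_rep c" "unit_rep c < 1"
proof -
  have "c = circle_of (SOME x. c = circle_of x)" using circle_of_surj by (rule someI_ex)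
  then show "circle_of (unit_rep c) = c"
    by (metis circle_of_eq_iff frac_def unit_rep_def Ints_of_int diff_diff_eq2 add_diff_cancel_left')
qed (simp_all add: unit_rep_def frac_lt_1)

text \<open>The differences are non-negative with sum zero. This lets one integer encode the
  itinerary of a block.\<close>

lemma sum_mono_eq_imp_eq:
  fixes f g :: "nat \<Rightarrow> int"
  assumes "\<And>k. k < m \<Longrightarrow> f k \<le> g k" "(\<Sum>k<m. f k) = (\<Sum>k<m. g k)" "k < m"
  shows "f k = g k"
proof -
  have "(\<Sum>k<m. g k - f k) = 0" using assms(2) by (simp add: sum_subtractf)
  then have "\<forall>k\<in>{..<m}. g k - f k = 0" by (subst (asm) sum_nonneg_eq_0_iff) (use assms(1) in auto)
  then show ?thesis using assms(3) by simp
qed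

lemma dist_prod_le: "dist (a, b) (c, d) \<le> dist a c + dist b d"
  unfolding dist_Pair_Pair by (intro sqrt_sum_squares_le_sum) auto

section \<open>Coding of orbit segments\<close>

context monotone_cocycle
begin

lemma iter_lipschitz_upto:
  obtains C where "C > 0"
    "\<And>k \<theta> x \<theta>' x'. k < m \<Longrightarrow> \<bar>iter k \<theta> x - iter k \<theta>' x'\<bar> \<le> C * (dist \<theta> \<theta>' + \<bar>x - x'\<bar>)"
proof -
  have "\<exists>C>0. \<forall>\<theta> x \<theta>' x'. \<bar>iter k \<theta> x - iter k \<theta>' x'\<bar> \<le> C * (dist \<theta> \<theta>' + \<bar>x - x'\<bar>)" for k
    using iter_lipschitz[of k] by metis
  then obtain c where c: "\<And>k. c k > 0"
    "\<And>k \<theta> x \<theta>' x'. \<bar>iter k \<theta> x - iter k \<theta>' x'\<bar> \<le> c k * (dist \<theta> \<theta>' + \<bar>x - x'\<bar>)" by metis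
  show ?thesis
  proof (rule that[of "1 + sum c {..<m}"])
    show "1 + sum c {..<m} > 0" using c(1) by (intro add_pos_nonneg sum_nonneg) (auto intro: less_imp_le)
    fix k :: nat and \<theta> \<theta>' :: circle and x x' :: real assume "k < m"
    then have "c k \<le> sum c {..<m}" using c(1) by (intro member_le_sum) (auto intro: less_imp_le)
    then have "c k * (dist \<theta> \<theta>' + \<bar>x - x'\<bar>) \<le> (1 + sum c {..<m}) * (dist \<theta> \<theta>' + \<bar>x - x'\<bar>)"
      by (intro mult_right_mono) auto
    with c(2)[of k \<theta> x \<theta>' x'] show "\<bar>iter k \<theta> x - iter k \<theta>' x'\<bar>
      \<le> (1 + sum c {..<m}) * (dist \<theta> \<theta>' + \<bar>x - x'\<bar>)" by linarith
  qed
qed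

text \<open>The cell indices are summed instead of listed: by monotonicity the itineraries over one
  base point are ordered componentwise, so the sum still distinguishes them.\<close>

definition block_code :: "nat \<Rightarrow> nat \<Rightarrow> circle \<Rightarrow> real \<Rightarrow> int" where
  "block_code q m \<theta> x = (\<Sum>k<m. \<lfloor>real q * iter k \<theta> x\<rfloor>)"

lemma block_code_mono: "x \<le> y \<Longrightarrow> block_code q m \<theta> x \<le> block_code q m \<theta> y"
  unfolding block_code_def by (intro sum_mono floor_mono mult_left_mono iter_mono) auto

text \<open>With \<open>block_code_mono\<close> this leaves at most \<open>m * q + 1\<close> codes
  over the unit interval, linear in \<open>m\<close> instead of exponential.\<close>

lemma block_code_one: "block_code q m \<theta> 1 = block_code q m \<theta> 0 + int (m * q)"
proof -
  have "\<lfloor>real q * iter k \<theta> 1\<rfloor> = \<lfloor>real q * iter k \<theta> 0\<rfloor> + int q" for k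
  proof -
    have "real q * iter k \<theta> 1 = real q * iter k \<theta> 0 + of_int (int q)"
      using iter_add_one[of k \<theta> 0] by (simp add: algebra_simps)
    then show ?thesis by (simp only: floor_add_int)
  qed
  then show ?thesis by (simp add: block_code_def sum.distrib)
qed

lemma block_code_eq_imp_close:
  assumes "block_code q m \<theta> x = block_code q m \<theta> y" "k < m" "q > 0"
  shows "\<bar>iter k \<theta> x - iter k \<theta> y\<bar> < 1 / real q"
proof -
  have "\<lfloor>real q * iter k \<theta> x\<rfloor> = \<lfloor>real q * iter k \<theta> y\<rfloor>"
  proof (cases "x \<le> y")
    case True
    show ?thesis
      by (rule sum_mono_eq_imp_eq[OF _ assms(1)[unfolded block_code_def] assms(2)])
         (intro floor_mono mult_left_mono iter_mono[OF True], simp)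
  next
    case False
    then have "y \<le> x" by simp
    show ?thesis
      by (rule sum_mono_eq_imp_eq[OF _ assms(1)[unfolded block_code_def, symmetric] assms(2), symmetric])
         (intro floor_mono mult_left_mono iter_mono[OF \<open>y \<le> x\<close>], simp)
  qed
  then have "\<bar>real q * iter k \<theta> x - real q * iter k \<theta> y\<bar> < 1" by linarith
  then have "real q * \<bar>iter k \<theta> x - iter k \<theta> y\<bar> < 1" by (simp add: abs_mult flip: right_diff_distrib)
  then show ?thesis using assms(3) by (simp add: field_simps)
qed

context
  fixes f :: "circle \<times> circle \<Rightarrow> circle \<times> circle" and M :: "(circle \<times> circle) set"
  assumes inv: "f ` M \<subseteq> M"
    and f_eq: "\<And>\<theta> x. (\<theta>, circle_of x) \<in> M \<Longrightarrow> f (\<theta>, circle_of x) = (\<theta> + \<omega>, circle_of (E \<theta> x))"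
begin

lemma funpow_in: "z \<in> M \<Longrightarrow> (f ^^ n) z \<in> M"
  using inv by (induction n) auto

lemma funpow_eq:
  "(\<theta>, circle_of x) \<in> M \<Longrightarrow> (f ^^ n) (\<theta>, circle_of x) = (rot n \<theta>, circle_of (iter n \<theta> x))"
proof (induction n)
  case (Suc n)
  then have "(rot n \<theta>, circle_of (iter n \<theta> x)) \<in> M" using funpow_in[OF Suc.prems, of n] by simp
  then show ?case using Suc f_eq by simp
qed simp

text \<open>An orbit segment is coded blockwise: within a block of length \<open>m\<close>, the whole itinerary with
  respect to the partition of the fibre into intervals of length \<open>1 / q\<close> is determined by a single
  integer, since all the fibre maps are monotone.\<close>

lemma card_separated:
  assumes q: "q > 0" and m: "m > 0"
  obtains N :: nat where "N > 0"
    "\<And>n \<epsilon> A. 5 / real q \<le> \<epsilon> \<Longrightarrow> finite A \<Longrightarrow> A \<subseteq> M \<Longrightarrow> dyn_separated f n \<epsilon> A \<Longrightarrow>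
       card A \<le> N * (m * q + 1) ^ (n div m + 1)"
proof -
  obtain C where C: "C > 0"
    "\<And>k \<theta> x \<theta>' x'. k < m \<Longrightarrow> \<bar>iter k \<theta> x - iter k \<theta>' x'\<bar> \<le> C * (dist \<theta> \<theta>' + \<bar>x - x'\<bar>)"
    using iter_lipschitz_upto[of m] by metis
  \<comment> \<open>Moving the base point by less than \<delta> changes the base position and,
    within one block, the fibre position by at most \<open>1 / real q\<close> each.\<close>
  define \<delta> where "\<delta> = 1 / (real q * (C + 1))"
  have \<delta>: "\<delta> > 0" "\<delta> \<le> 1 / real q" "C * \<delta> \<le> 1 / real q"
  proof -
    have "0 < real q + C * real q" using q C(1) by (intro add_pos_pos mult_pos_pos) auto
    then show "\<delta> > 0" "\<delta> \<le> 1 / real q" "C * \<delta> \<le> 1 / real q"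
      using q C(1) by (simp_all add: \<delta>_def field_simps)
  qed
  have cover: "(UNIV :: circle set) \<subseteq> (\<Union>c\<in>UNIV. ball c \<delta>)" using \<delta>(1) by auto
  obtain T where T: "finite T" "(UNIV :: circle set) \<subseteq> (\<Union>c\<in>T. ball c \<delta>)"
    using compactE_image[OF compact_UNIV_circle _ cover] open_ball by metis
  have "\<exists>c\<in>T. dist c \<theta> < \<delta>" for \<theta>
  proof -
    have "\<theta> \<in> (\<Union>c\<in>T. ball c \<delta>)" using T(2) by blast
    then show ?thesis by auto
  qed
  then obtain cen where cen: "\<And>\<theta>. cen \<theta> \<in> T" "\<And>\<theta>. dist (cen \<theta>) \<theta> < \<delta>" by metis
  have "T \<noteq> {}" using cen(1) by blast
  \<comment> \<open>Each block restarts from a representative in the unit interval, which keeps the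
    codes bounded.\<close>
  define X where "X j z = unit_rep (snd ((f ^^ (j * m)) z))" for j z
  \<comment> \<open>The code is taken along the orbit of the centre, so that points with the same
    centre are coded by the same monotone function; subtracting the code of 0 moves its values into
    the range from 0 to \<open>m * q\<close>.\<close>
  define s where "s j z = nat (block_code q m (rot (j * m) (cen (fst z))) (X j z)
      - block_code q m (rot (j * m) (cen (fst z))) 0)" for j z
  have X01: "0 \<le> X j z" "X j z < 1" for j z unfolding X_def by (rule unit_rep)+
  have s_bound: "s j z \<le> m * q" for j z
    using block_code_mono[of "X j z" 1 q m] X01(2)[of j z] block_code_one[of q m]
    by (simp add: s_def nat_le_iff) (smt (verit) of_nat_mult)
  have s_inj: "block_code q m (rot (j * m) (cen (fst z))) (X j z)
      = block_code q m (rot (j * m) (cen (fst z))) (X j z')"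
    if "s j z = s j z'" "cen (fst z) = cen (fst z')" for j z z'
    using that block_code_mono[OF X01(1)[of j z], of q m "rot (j * m) (cen (fst z))"]
      block_code_mono[OF X01(1)[of j z'], of q m "rot (j * m) (cen (fst z))"]
    by (simp add: s_def)
  have orbit: "(f ^^ (j * m + k)) z = (rot (j * m + k) (fst z), circle_of (iter k (rot (j * m) (fst z)) (X j z)))"
    if "z \<in> M" for j k z
  proof -
    obtain x where x: "snd z = circle_of x" using circle_of_surj by blast
    have z: "z = (fst z, circle_of x)" by (simp flip: x)
    have "fst ((f ^^ n) z) = rot n (fst z)" for n
      using funpow_eq[of "fst z" x n] that z by (metis fst_conv)
    then have 1: "(f ^^ (j * m)) z = (rot (j * m) (fst z), circle_of (X j z))"
      by (simp add: X_def unit_rep prod_eq_iff)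
    have "(f ^^ (j * m + k)) z = (f ^^ k) ((f ^^ (j * m)) z)"
      by (subst add.commute) (simp add: funpow_add)
    also have "\<dots> = (rot k (rot (j * m) (fst z)), circle_of (iter k (rot (j * m) (fst z)) (X j z)))"
      using funpow_in[OF that, of "j * m"] unfolding 1 by (rule funpow_eq)
    also have "rot k (rot (j * m) (fst z)) = rot (j * m + k) (fst z)"
      by (subst add.commute) (simp add: funpow_add)
    finally show ?thesis .
  qed
  \<comment> \<open>Three of the five units bound the fibre coordinate, one for equal codes and two
    for passing to the centre; the other two bound the base coordinate.\<close>
  have close: "dist ((f ^^ (j * m + k)) z) ((f ^^ (j * m + k)) z') \<le> 5 / real q"
    if zz: "z \<in> M" "z' \<in> M" and eq: "s j z = s j z'" "cen (fst z) = cen (fst z')" and k: "k < m" for j k z z'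
  proof -
    define c where "c = cen (fst z)"
    have c: "dist c (fst z) < \<delta>" "dist c (fst z') < \<delta>" using cen(2) eq(2) unfolding c_def by metis+
    have C\<delta>: "\<bar>iter k (rot (j * m) c) x - iter k (rot (j * m) \<theta>) x\<bar> \<le> 1 / real q"
      if "dist c \<theta> < \<delta>" for \<theta> x
    proof -
      have "\<bar>iter k (rot (j * m) c) x - iter k (rot (j * m) \<theta>) x\<bar> \<le> C * dist c \<theta>"
        using C(2)[OF k, of "rot (j * m) c" x "rot (j * m) \<theta>" x] by (simp add: dist_funpow_rotation)
      also have "\<dots> \<le> C * \<delta>" using that C(1) by simp
      finally show ?thesis using \<delta>(3) by simp
    qed
    have "\<bar>iter k (rot (j * m) c) (X j z) - iter k (rot (j * m) c) (X j z')\<bar> < 1 / real q"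
      using s_inj[OF eq] k q unfolding c_def[symmetric] by (rule block_code_eq_imp_close)
    then have "\<bar>iter k (rot (j * m) (fst z)) (X j z) - iter k (rot (j * m) (fst z')) (X j z')\<bar> \<le> 3 * (1 / real q)"
      using C\<delta>[OF c(1), of "X j z"] C\<delta>[OF c(2), of "X j z'"] by linarith
    then have "dist (circle_of (iter k (rot (j * m) (fst z)) (X j z)))
        (circle_of (iter k (rot (j * m) (fst z')) (X j z'))) \<le> 3 * (1 / real q)"
      using dist_circle_of_le order_trans unfolding dist_real_def by blast
    moreover have "dist (rot (j * m + k) (fst z)) (rot (j * m + k) (fst z')) \<le> 2 * (1 / real q)"
      using c dist_triangle3[of "fst z" "fst z'" c] \<delta>(2) unfolding dist_funpow_rotation by linarith
    ultimately show ?thesis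
      unfolding orbit[OF zz(1)] orbit[OF zz(2)]
      by (intro order_trans[OF dist_prod_le]) simp
  qed
  show ?thesis
  proof (rule that[of "card T"])
    show "card T > 0" using T(1) \<open>T \<noteq> {}\<close> by (simp add: card_gt_0_iff)
    fix n \<epsilon> A
    assume \<epsilon>: "5 / real q \<le> \<epsilon>" and A: "finite A" "A \<subseteq> M" "dyn_separated f n \<epsilon> A"
    \<comment> \<open>This many blocks of length \<open>m\<close> cover all times below
      \<open>n\<close>.\<close>
    define K where "K = n div m + 1"
    define code where "code z = (cen (fst z), restrict (\<lambda>j. s j z) {..<K})" for z
    have "inj_on code A"
    proof (rule inj_onI, rule ccontr)
      fix z z' assume z: "z \<in> A" "z' \<in> A" "code z = code z'" "z \<noteq> z'"
      then obtain i where i: "i < n" "\<epsilon> < dist ((f ^^ i) z) ((f ^^ i) z')"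
        using A(3) unfolding dyn_separated_def by blast
      define j where "j = i div m"
      have "j < K" using i(1) by (simp add: j_def K_def div_le_mono less_Suc_eq_le)
      have "restrict (\<lambda>j. s j z) {..<K} j = restrict (\<lambda>j. s j z') {..<K} j" "cen (fst z) = cen (fst z')"
        using z(3) by (simp_all add: code_def)
      then have "s j z = s j z'" "cen (fst z) = cen (fst z')" using \<open>j < K\<close> by simp_all
      moreover have "z \<in> M" "z' \<in> M" using z A(2) by auto
      ultimately have "dist ((f ^^ (j * m + i mod m)) z) ((f ^^ (j * m + i mod m)) z') \<le> 5 / real q"
        using m by (intro close) auto
      then show False using i(2) \<epsilon> by (simp add: j_def)
    qed
    moreover have "code ` A \<subseteq> T \<times> ({..<K} \<rightarrow>\<^sub>E {0..m * q})"
      using cen(1) s_bound by (auto simp: code_def restrict_def PiE_def extensional_def Pi_def)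
    moreover have "finite (T \<times> ({..<K} \<rightarrow>\<^sub>E {0..m * q}))"
      using T(1) by (intro finite_cartesian_product finite_PiE) auto
    ultimately have "card A \<le> card (T \<times> ({..<K} \<rightarrow>\<^sub>E {0..m * q}))" by (rule card_inj_on_le)
    also have "\<dots> = card T * (m * q + 1) ^ K" by (simp add: card_cartesian_product card_PiE)
    finally show "card A \<le> card T * (m * q + 1) ^ (n div m + 1)" by (simp add: K_def)
  qed
qed

text \<open>By \<open>card_separated\<close> the growth rate is at most
  \<open>ln (m * q + 1) / m\<close> for every block length \<open>m\<close>, which tends to 0 as
  \<open>m\<close> grows with \<open>q\<close> fixed.\<close>

lemma separated_growth:
  assumes "\<epsilon> > 0" "e > 0"
  shows "\<exists>n0. \<forall>n\<ge>n0. \<forall>A. finite A \<longrightarrow> A \<subseteq> M \<longrightarrow> dyn_separated f n \<epsilon> A \<longrightarrow>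
           ln (real (card A)) / real n \<le> e"
proof -
  obtain q :: nat where q: "5 / \<epsilon> < real q" using reals_Archimedean2 by blast
  then have q0: "q > 0" using assms(1) by (cases q) (auto simp: field_simps)
  have "(\<lambda>m. ln (real m) / real m + ln (real (q + 1)) * (1 / real m)) \<longlonglongrightarrow> 0 + ln (real (q + 1)) * 0"
    by (intro tendsto_intros lim_ln_over_n lim_1_over_n)
  then have "\<forall>\<^sub>F m in sequentially. ln (real m) / real m + ln (real (q + 1)) * (1 / real m) < e / 2"
    using assms(2) by (intro order_tendstoD) auto
  then obtain m where m0: "m > 0" "ln (real m) / real m + ln (real (q + 1)) * (1 / real m) < e / 2"
    using eventually_happens[OF eventually_conj[OF eventually_gt_at_top[of "0::nat"]]]
    by (metis (no_types, lifting) sequentially_bot)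
  have "ln (real (m * q + 1)) \<le> ln (real (m * (q + 1)))"
    using m0(1) by (intro ln_mono) (simp_all only: of_nat_le_iff of_nat_0_less_iff, simp_all)
  also have "\<dots> = ln (real m) + ln (real (q + 1))"
    using m0(1) by (simp only: of_nat_mult) (subst ln_mult_pos, auto)
  finally have "ln (real (m * q + 1)) / real m \<le> (ln (real m) + ln (real (q + 1))) / real m"
    by (rule divide_right_mono) simp
  also have "\<dots> < e / 2" using m0(2) by (simp only: add_divide_distrib times_divide_eq_right mult_1_right)
  finally have m: "m > 0" "ln (real (m * q + 1)) / real m < e / 2" using m0(1) by simp_all
  obtain N where N: "N > 0"
    "\<And>n \<epsilon> A. 5 / real q \<le> \<epsilon> \<Longrightarrow> finite A \<Longrightarrow> A \<subseteq> M \<Longrightarrow> dyn_separated f n \<epsilon> A \<Longrightarrow>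
       card A \<le> N * (m * q + 1) ^ (n div m + 1)"
    using card_separated[OF q0 m(1)] by metis
  define b where "b = ln (real (m * q + 1))"
  have b: "b \<ge> 0" "b / real m < e / 2" using m(2) by (simp_all add: b_def)
  have pos: "0 < real (m * q + 1)" by (simp only: of_nat_0_less_iff)
  define B where "B = ln (real N) + b"
  obtain n0 :: nat where n0: "2 * B / e < real n0" using reals_Archimedean2 by blast
  show ?thesis
  proof (intro exI allI impI)
    fix n A assume n: "n \<ge> Suc n0" and A: "finite A" "A \<subseteq> M" "dyn_separated f n \<epsilon> A"
    have n': "real n > 0" "2 * B / e < real n" using n n0 by auto
    show "ln (real (card A)) / real n \<le> e"
    proof (cases "A = {}")
      case False
      have "5 / real q \<le> \<epsilon>" using q q0 assms(1) by (simp add: field_simps)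
      from N(2)[OF this A] have "real (card A) \<le> real (N * (m * q + 1) ^ (n div m + 1))"
        by (simp only: of_nat_le_iff)
      moreover have "card A > 0" using False A(1) by (simp add: card_gt_0_iff)
      ultimately have "ln (real (card A)) \<le> ln (real (N * (m * q + 1) ^ (n div m + 1)))"
        by (subst ln_le_cancel_iff) (use N(1) in auto)
      also have "\<dots> = ln (real N * real (m * q + 1) ^ (n div m + 1))"
        by (simp only: of_nat_mult[of N] of_nat_power)
      also have "\<dots> = ln (real N) + ln (real (m * q + 1) ^ (n div m + 1))"
        by (rule ln_mult_pos[OF _ zero_less_power[OF pos]]) (use N(1) in simp)
      also have "ln (real (m * q + 1) ^ (n div m + 1)) = real (n div m + 1) * b"
        unfolding b_def by (rule ln_realpow)
      also have "ln (real N) + real (n div m + 1) * b = B + real (n div m) * b"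
        by (simp add: B_def algebra_simps)
      also have "\<dots> \<le> B + real n / real m * b"
        using b(1) by (intro add_left_mono mult_right_mono of_nat_div_le_of_nat) auto
      also have "\<dots> = B + real n * (b / real m)" by simp
      also have "\<dots> \<le> e / 2 * real n + real n * (e / 2)"
        using n' b(2) assms(2) by (intro add_mono mult_left_mono) (auto simp: field_simps)
      finally show ?thesis using n'(1) by (simp add: field_simps)
    qed (use assms(2) in simp)
  qed
qed

lemma htop_on_zero:
  assumes "M \<noteq> {}"
  shows "htop_on f M = 0"
proof (rule antisym)
  show "htop_on f M \<le> 0"
    unfolding htop_on_def
  proof (rule SUP_least)
    fix \<epsilon> :: real assume "\<epsilon> \<in> {0<..}"
    then have \<epsilon>: "\<epsilon> > 0" by simp
    show "limsup (\<lambda>n. SUP A\<in>{A. finite A \<and> A \<subseteq> M \<and> dyn_separated f n \<epsilon> A}.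
          ereal (ln (real (card A)) / real n)) \<le> 0"
    proof (rule ereal_le_epsilon2)
      fix e :: real assume "e > 0"
      from separated_growth[OF \<epsilon> this] obtain n0 where n0: "\<And>n A. n \<ge> n0 \<Longrightarrow> finite A \<Longrightarrow> A \<subseteq> M \<Longrightarrow>
          dyn_separated f n \<epsilon> A \<Longrightarrow> ln (real (card A)) / real n \<le> e" by metis
      have "\<forall>\<^sub>F n in sequentially.
          (SUP A\<in>{A. finite A \<and> A \<subseteq> M \<and> dyn_separated f n \<epsilon> A}. ereal (ln (real (card A)) / real n)) \<le> ereal e"
        unfolding eventually_sequentially by (intro exI[of _ n0] allI impI SUP_least) (simp add: n0)
      then show "limsup (\<lambda>n. SUP A\<in>{A. finite A \<and> A \<subseteq> M \<and> dyn_separated f n \<epsilon> A}.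
          ereal (ln (real (card A)) / real n)) \<le> 0 + ereal e"
        by (simp add: Limsup_bounded)
    qed
  qed
  \<comment> \<open>A singleton is separated and contributes \<open>ln 1 = 0\<close>, which bounds
    the entropy from below.\<close>
  obtain z where z: "z \<in> M" using assms by blast
  have "0 \<le> limsup (\<lambda>n. SUP A\<in>{A. finite A \<and> A \<subseteq> M \<and> dyn_separated f n 1 A}.
          ereal (ln (real (card A)) / real n))"
  proof (rule le_Limsup)
    show "\<forall>\<^sub>F n in sequentially. 0 \<le> (SUP A\<in>{A. finite A \<and> A \<subseteq> M \<and> dyn_separated f n 1 A}.
          ereal (ln (real (card A)) / real n))"
    proof (intro always_eventually allI)
      fix n
      have "{z} \<in> {A. finite A \<and> A \<subseteq> M \<and> dyn_separated f n 1 A}"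
        using z by (simp add: dyn_separated_def)
      from SUP_upper[OF this, of "\<lambda>A. ereal (ln (real (card A)) / real n)"]
      show "0 \<le> (SUP A\<in>{A. finite A \<and> A \<subseteq> M \<and> dyn_separated f n 1 A}. ereal (ln (real (card A)) / real n))"
        by (simp add: zero_ereal_def)
    qed
  qed simp
  also have "\<dots> \<le> htop_on f M"
    unfolding htop_on_def by (rule SUP_upper2[of 1]) auto
  finally show "0 \<le> htop_on f M" .
qed

end

end

section \<open>The forced Arnold map\<close>

lemma unit_rep_circle_of: "0 \<le> t \<Longrightarrow> t < 1 \<Longrightarrow> unit_rep (circle_of t) = t"
proof -
  assume t: "0 \<le> t" "t < 1"
  have "unit_rep (circle_of t) - t \<in> \<int>" using unit_rep(1)[of "circle_of t"] by (simp add: circle_of_eq_iff)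
  then obtain k where k: "unit_rep (circle_of t) - t = of_int k" by (rule Ints_cases)
  have "-1 < real_of_int k" "real_of_int k < 1"
    using t unit_rep(2,3)[of "circle_of t"] unfolding k[symmetric] by linarith+
  then have "k = 0" by linarith
  then show ?thesis using k by simp
qed

lemma continuous_on_circle_add:
  assumes "continuous_on S f" "continuous_on S g"
  shows "continuous_on S (\<lambda>z. f z + (g z :: circle))"
proof -
  have "continuous_on UNIV (\<lambda>p. fst p + (snd p :: circle))"
    unfolding continuous_on_iff
  proof (intro ballI allI impI)
    fix p :: "circle \<times> circle" and e :: real assume "e > 0"
    have "dist (fst q + snd q) (fst p + snd p) < e" if "dist q p < e / 2" for q :: "circle \<times> circle"
    proof -
      have "dist (fst q + snd q) (fst p + snd p) \<le> dist (fst q + snd q) (fst p + snd q) + dist (fst p + snd q) (fst p + snd p)"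
        by (rule dist_triangle)
      also have "\<dots> = dist (fst q) (fst p) + dist (snd q) (snd p)"
        using dist_circle_add[of "snd q" "fst p" "snd p"] by (simp add: dist_circle_add add.commute)
      also have "\<dots> \<le> dist q p + dist q p" by (intro add_mono dist_fst_le dist_snd_le)
      finally show ?thesis using that by simp
    qed
    then show "\<exists>d>0. \<forall>q\<in>UNIV. dist q p < d \<longrightarrow> dist (fst q + snd q) (fst p + snd p) < e"
      using \<open>e > 0\<close> by (intro exI[of _ "e / 2"]) auto
  qed
  from continuous_on_compose2[OF this continuous_on_Pair[OF assms]] show ?thesis by simp
qed

lemma continuous_on_sin2pi: "continuous_on S sin2pi"
proof (rule lipschitz_on_continuous_on)
  show "(2 * pi)-lipschitz_on S sin2pi"
    using sin2pi_lipschitz by (intro lipschitz_onI) (auto simp: dist_real_def)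
qed

text \<open>The lift to the unit interval starting at \<open>a\<close>, continuous away from the cut
  point \<open>circle_of a\<close>.\<close>

definition cut_chart :: "real \<Rightarrow> circle \<Rightarrow> real" where
  "cut_chart a c = a + unit_rep (c - circle_of a)"

lemma circle_of_cut_chart: "circle_of (cut_chart a c) = c"
  by (simp add: cut_chart_def circle_of_add unit_rep(1))

lemma cut_chart_bounds: "a \<le> cut_chart a c" "cut_chart a c < a + 1"
  using unit_rep(2,3)[of "c - circle_of a"] by (simp_all add: cut_chart_def)

lemma cut_chart_circle_of: "a \<le> y \<Longrightarrow> y < a + 1 \<Longrightarrow> cut_chart a (circle_of y) = y"
  using unit_rep_circle_of[of "y - a"] by (simp add: cut_chart_def circle_of_diff)

lemma continuous_on_cut_chart: "continuous_on (- {circle_of a}) (cut_chart a)"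
  unfolding continuous_on_iff
proof (intro ballI allI impI)
  fix c and e :: real assume c: "c \<in> - {circle_of a}" and "e > 0"
  define x where "x = cut_chart a c"
  have x: "circle_of x = c" "x < a + 1" "a \<le> x" unfolding x_def
    by (simp_all add: circle_of_cut_chart cut_chart_bounds)
  moreover have "x \<noteq> a" using x(1) c by auto
  ultimately have ax: "a < x" by simp
  define d where "d = min e (min (x - a) (a + 1 - x))"
  have "dist (cut_chart a c') (cut_chart a c) < e" if "dist c' c < d" for c'
  proof -
    obtain y where y: "c' = circle_of y" "\<bar>y - x\<bar> = dist c' (circle_of x)"
      using circle_dist_representative by metis
    then have "\<bar>y - x\<bar> < d" using that x(1) by simp
    then have "a \<le> y" "y < a + 1" "\<bar>y - x\<bar> < e" unfolding d_def by linarith+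
    then show ?thesis unfolding y(1) x_def[symmetric] by (simp add: cut_chart_circle_of dist_real_def)
  qed
  moreover have "d > 0" using \<open>e > 0\<close> ax x(2) by (simp add: d_def)
  ultimately show "\<exists>d>0. \<forall>c'\<in>- {circle_of a}. dist c' c < d \<longrightarrow> dist (cut_chart a c') (cut_chart a c) < e"
    by blast
qed

context monotone_cocycle
begin

text \<open>\<open>B\<close> is chosen before \<open>G\<close> and \<open>d\<close>, so one constant
  serves all nearby parameters at the fixed time \<open>n\<close>.\<close>

lemma iter_perturb:
  obtains B where "B > 0"
    "\<And>G d \<theta> x. (\<And>\<theta> x. \<bar>G \<theta> x - E \<theta> x\<bar> \<le> d) \<Longrightarrow> \<bar>fib_iterate \<omega> G n \<theta> x - iter n \<theta> x\<bar> \<le> d * B"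
proof -
  have "\<exists>B>0. \<forall>G d. (\<forall>\<theta> x. \<bar>G \<theta> x - E \<theta> x\<bar> \<le> d) \<longrightarrow>
      (\<forall>\<theta> x. \<bar>fib_iterate \<omega> G n \<theta> x - iter n \<theta> x\<bar> \<le> d * B)"
  proof (induction n)
    case 0
    have "0 \<le> d" if "\<forall>\<theta> x. \<bar>G \<theta> x - E \<theta> x\<bar> \<le> d" for G d
      using that[rule_format, of 0 0] by linarith
    then show ?case by (intro exI[of _ 1]) auto
  next
    case (Suc n)
    then obtain B where B: "B > 0" "\<And>G d \<theta> x. (\<forall>\<theta> x. \<bar>G \<theta> x - E \<theta> x\<bar> \<le> d) \<Longrightarrow>
      \<bar>fib_iterate \<omega> G n \<theta> x - iter n \<theta> x\<bar> \<le> d * B" by blast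
    have "\<bar>fib_iterate \<omega> G (Suc n) \<theta> x - iter (Suc n) \<theta> x\<bar> \<le> d * (1 + L * B)"
      if G: "\<forall>\<theta> x. \<bar>G \<theta> x - E \<theta> x\<bar> \<le> d" for G d \<theta> x
    proof -
      let ?g = "fib_iterate \<omega> G n \<theta> x" and ?e = "iter n \<theta> x"
      have "\<bar>E (rot n \<theta>) ?g - E (rot n \<theta>) ?e\<bar> \<le> L * \<bar>?g - ?e\<bar>"
        using lipschitz[of "rot n \<theta>" ?g "rot n \<theta>" ?e] by simp
      also have "\<dots> \<le> L * (d * B)" using B(2)[OF G, of \<theta> x] L_ge_1 by (intro mult_left_mono) auto
      finally show ?thesis using G[rule_format, of "rot n \<theta>" ?g] by (simp add: algebra_simps)
    qed
    moreover have "1 + L * B > 0" using B(1) L_ge_1 by (simp add: add_pos_pos)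
    ultimately show ?case by blast
  qed
  then show ?thesis using that by blast
qed

end

lemma uniform_rotation_uniform_limit:
  assumes "uniform_rotation \<omega> E r"
  shows "uniform_limit UNIV (\<lambda>n (\<theta>, x). (fib_iterate \<omega> E n \<theta> x - x) / real n) (\<lambda>_. r) sequentially"
proof (rule uniform_limitI)
  fix e :: real assume "e > 0"
  then obtain N where N: "\<And>n \<theta> x. n \<ge> N \<Longrightarrow> \<bar>fib_iterate \<omega> E n \<theta> x - x - real n * r\<bar> \<le> e / 2 * real n"
    using assms half_gt_zero[OF \<open>e > 0\<close>] unfolding uniform_rotation_def by metis
  show "\<forall>\<^sub>F n in sequentially. \<forall>p\<in>UNIV. dist ((\<lambda>(\<theta>, x). (fib_iterate \<omega> E n \<theta> x - x) / real n) p) r < e"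
    using eventually_ge_at_top[of N] eventually_gt_at_top[of 0]
  proof eventually_elim
    case (elim n)
    show ?case
    proof
      fix p :: "circle \<times> real"
      obtain \<theta> x where p: "p = (\<theta>, x)" by (cases p)
      have "(fib_iterate \<omega> E n \<theta> x - x) / real n - r = (fib_iterate \<omega> E n \<theta> x - x - real n * r) / real n"
        using elim(2) by (simp add: field_simps)
      then have "\<bar>(fib_iterate \<omega> E n \<theta> x - x) / real n - r\<bar> \<le> e / 2"
        using N[OF elim(1), of \<theta> x] elim(2) by (simp add: abs_divide field_simps)
      then show "dist ((\<lambda>(\<theta>, x). (fib_iterate \<omega> E n \<theta> x - x) / real n) p) r < e"
        using \<open>e > 0\<close> by (simp add: p dist_real_def)
    qed
  qed
qed

lemma uniform_rotation_tendsto: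
  assumes "uniform_rotation \<omega> E r"
  shows "(\<lambda>n. (fib_iterate \<omega> E n \<theta> x - x) / real n) \<longlonglongrightarrow> r"
  using tendsto_uniform_limitI[OF uniform_rotation_uniform_limit[OF assms], of "(\<theta>, x)"] by simp

section \<open>The unforced Arnold family\<close>

definition arnold_base :: "real \<Rightarrow> real \<Rightarrow> real \<Rightarrow> real" where
  "arnold_base \<tau> \<alpha> x = x + \<tau> + \<alpha> / (2 * pi) * sin (2 * pi * x)"

lemma arnold_fibre_eq: "arnold_fibre \<tau> \<alpha> \<beta> \<theta> x = arnold_base \<tau> \<alpha> x + \<beta> * sin2pi \<theta>"
  by (simp add: arnold_fibre_def arnold_base_def)

lemma arnold_base_dol: "degree_one_lipschitz (1 + \<bar>\<alpha>\<bar>) (arnold_base \<tau> \<alpha>)"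
  unfolding degree_one_lipschitz_def
proof (intro conjI allI)
  show "arnold_base \<tau> \<alpha> (x + 1) = arnold_base \<tau> \<alpha> x + 1" for x
    by (simp add: arnold_base_def distrib_left)
  fix x y
  have triangle: "\<bar>x + \<tau> + u - (y + \<tau> + v)\<bar> \<le> 1 * \<bar>x - y\<bar> + A" if "\<bar>u - v\<bar> \<le> A" for u v A
    using that by simp
  have "\<bar>sin (2 * pi * x) - sin (2 * pi * y)\<bar> \<le> \<bar>2 * pi * x - 2 * pi * y\<bar>"
    by (rule abs_sin_diff_le_abs_diff)
  also have "\<dots> = 2 * pi * \<bar>x - y\<bar>" by (simp add: abs_mult flip: right_diff_distrib)
  finally have "\<bar>\<alpha>\<bar> / (2 * pi) * \<bar>sin (2 * pi * x) - sin (2 * pi * y)\<bar> \<le> \<bar>\<alpha>\<bar> / (2 * pi) * (2 * pi * \<bar>x - y\<bar>)"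
    by (intro mult_left_mono) auto
  also have "\<dots> = \<bar>\<alpha>\<bar> * \<bar>x - y\<bar>" by simp
  also have "\<bar>\<alpha>\<bar> / (2 * pi) * \<bar>sin (2 * pi * x) - sin (2 * pi * y)\<bar>
      = \<bar>\<alpha> / (2 * pi) * sin (2 * pi * x) - \<alpha> / (2 * pi) * sin (2 * pi * y)\<bar>"
    by (simp only: right_diff_distrib[symmetric] abs_mult) simp
  finally show "\<bar>arnold_base \<tau> \<alpha> x - arnold_base \<tau> \<alpha> y\<bar> \<le> (1 + \<bar>\<alpha>\<bar>) * \<bar>x - y\<bar>"
    unfolding arnold_base_def distrib_right by (rule triangle)
qed

text \<open>The derivative at \<open>1 / 2\<close> is \<open>1 - \<alpha>\<close>, which is
  negative. Every truncation, being monotone, must therefore differ from the base map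
  somewhere.\<close>

lemma arnold_base_not_mono:
  assumes "\<alpha> > 1"
  obtains x y where "x < y" "arnold_base \<tau> \<alpha> y < arnold_base \<tau> \<alpha> x"
proof -
  have "(arnold_base \<tau> \<alpha> has_real_derivative (1 - \<alpha>)) (at (1 / 2))"
    unfolding arnold_base_def[abs_def] by (auto intro!: derivative_eq_intros)
  from has_real_derivative_neg_dec_right[OF this] obtain d where
    d: "d > 0" "\<And>t. 0 < t \<Longrightarrow> t < d \<Longrightarrow> arnold_base \<tau> \<alpha> (1 / 2 + t) < arnold_base \<tau> \<alpha> (1 / 2)"
    using assms by auto
  show ?thesis using that[of "1 / 2" "1 / 2 + d / 2"] d(1) d(2)[of "d / 2"] by simp
qed

text \<open>The amplitude bound makes every local maximum exceed each of the next two local minima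
  by at least one.\<close>

lemma arnold_base_env_gap:
  assumes "\<bar>\<alpha>\<bar> \<ge> 5 / 2 * pi"
  shows "lower_env (arnold_base \<tau> \<alpha>) x + 1 \<le> upper_env (arnold_base \<tau> \<alpha>) x"
proof -
  note dol = arnold_base_dol[of \<alpha> \<tau>]
  define s where "s = \<bar>\<alpha>\<bar> / (2 * pi)"
  have s: "s \<ge> 5 / 4" using assms by (simp add: s_def field_simps)
  \<comment> \<open>The sine term, taken with the sign of \<alpha>, is maximal at \<open>c\<close>
    and minimal half a period later.\<close>
  obtain c where c: "\<alpha> / (2 * pi) * sin (2 * pi * c) = s" "\<alpha> / (2 * pi) * sin (2 * pi * (c + 1 / 2)) = - s"
  proof (cases "\<alpha> \<ge> 0")
    case True
    have "sin (2 * pi * (1 / 4)) = 1" by simp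
    moreover have "2 * pi * (1 / 4 + 1 / 2) = 2 * pi * (1 / 4) + pi" by (simp add: field_simps)
    then have "sin (2 * pi * (1 / 4 + 1 / 2)) = - 1" by (simp only: sin_periodic_pi) simp
    ultimately show ?thesis using that[of "1 / 4"] True by (simp add: s_def)
  next
    case False
    have "sin (2 * pi * (- (1 / 4))) = - 1" by simp
    moreover have "2 * pi * (- (1 / 4) + 1 / 2) = 2 * pi * (- (1 / 4)) + pi" by (simp add: field_simps)
    then have "sin (2 * pi * (- (1 / 4) + 1 / 2)) = 1" by (simp only: sin_periodic_pi) simp
    ultimately show ?thesis using that[of "- (1 / 4)"] False by (simp add: s_def)
  qed
  \<comment> \<open>The last maximum of the sine term not after \<open>x\<close>. The minimum at
    \<open>y + 1 / 2\<close> may lie before \<open>x\<close>, so the one at \<open>y + 3 / 2\<close>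
    is used; the values differ by \<open>2 * s - 3 / 2 \<ge> 1\<close>.\<close>
  define y where "y = c + of_int \<lfloor>x - c\<rfloor>"
  have y: "y \<le> x" "x < y + 1" unfolding y_def by linarith+
  have shift: "arnold_base \<tau> \<alpha> (t + of_int k) = arnold_base \<tau> \<alpha> t + of_int k" for t k
    by (rule degree_one_int) (rule dol_add_one[OF dol])
  have hy: "arnold_base \<tau> \<alpha> y = y + \<tau> + s"
    using c(1) unfolding y_def shift by (simp add: arnold_base_def)
  have "arnold_base \<tau> \<alpha> (c + 1 / 2 + of_int \<lfloor>x - c\<rfloor>) = c + 1 / 2 + of_int \<lfloor>x - c\<rfloor> + \<tau> - s"
    using c(2) unfolding shift by (simp add: arnold_base_def)
  then have hz: "arnold_base \<tau> \<alpha> (y + 1 / 2) = y + 1 / 2 + \<tau> - s" by (simp add: y_def algebra_simps)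
  then have hz': "arnold_base \<tau> \<alpha> (y + 1 / 2 + 1) = y + 3 / 2 + \<tau> - s"
    using dol_add_one[OF dol, of "y + 1 / 2"] by simp
  have "lower_env (arnold_base \<tau> \<alpha>) x \<le> arnold_base \<tau> \<alpha> (y + 1 / 2 + 1)"
    using y by (intro lower_env_le[OF dol]) simp
  moreover have "arnold_base \<tau> \<alpha> y \<le> upper_env (arnold_base \<tau> \<alpha>) x"
    using y by (intro upper_env_ge[OF dol])
  ultimately show ?thesis using hy hz' s by linarith
qed

lemma arnold_map_proj:
  "arnold_map \<omega> \<tau> \<alpha> \<beta> (\<theta>, circle_of x) = (\<theta> + \<omega>, circle_of (arnold_fibre \<tau> \<alpha> \<beta> \<theta> x))"
  using arnold_lift_semiconj[of \<omega> \<tau> \<alpha> \<beta> "(\<theta>, x)"] by (simp add: torus_proj_def arnold_lift_def)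

lemma arnold_map_funpow:
  "(arnold_map \<omega> \<tau> \<alpha> \<beta> ^^ n) (\<theta>, circle_of x)
     = (((\<lambda>\<theta>. \<theta> + \<omega>) ^^ n) \<theta>, circle_of (fib_iterate \<omega> (arnold_fibre \<tau> \<alpha> \<beta>) n \<theta> x))"
  by (induction n) (simp_all add: arnold_map_proj)

lemma continuous_arnold_map: "continuous_on UNIV (arnold_map \<omega> \<tau> \<alpha> \<beta>)"
proof -
  have 1: "continuous_on UNIV (\<lambda>z :: circle \<times> circle. sin2pi (fst z))"
    by (rule continuous_on_compose2[OF continuous_on_sin2pi[of UNIV]]) (auto intro: continuous_intros)
  have 2: "continuous_on UNIV (\<lambda>z :: circle \<times> circle. sin2pi (snd z))"
    by (rule continuous_on_compose2[OF continuous_on_sin2pi[of UNIV]]) (auto intro: continuous_intros)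
  have "continuous_on UNIV (\<lambda>z. (fst z + \<omega>,
      snd z + circle_of (\<tau> + \<alpha> / (2 * pi) * sin2pi (snd z) + \<beta> * sin2pi (fst z))))"
    by (intro continuous_on_Pair continuous_on_circle_add continuous_on_fst continuous_on_snd
        continuous_on_id continuous_on_const
        continuous_on_compose2[OF continuous_on_circle_of[of UNIV]]
        continuous_on_add continuous_on_mult 1 2) simp
  moreover have "arnold_map \<omega> \<tau> \<alpha> \<beta> = (\<lambda>z. (fst z + \<omega>,
      snd z + circle_of (\<tau> + \<alpha> / (2 * pi) * sin2pi (snd z) + \<beta> * sin2pi (fst z))))"
    by (auto simp: arnold_map_def fun_eq_iff)
  ultimately show ?thesis by simp
qed

section \<open>Truncated cocycles and their rotation numbers\<close>

locale forced_arnold =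
  fixes \<omega> :: circle and \<tau> \<alpha> \<beta> :: real
  assumes irrational: "\<omega> \<notin> circle_of ` \<rat>"
begin

abbreviation "h \<equiv> arnold_base \<tau> \<alpha>"
abbreviation "F \<equiv> arnold_fibre \<tau> \<alpha> \<beta>"
abbreviation "f \<equiv> arnold_map \<omega> \<tau> \<alpha> \<beta>"

text \<open>The forcing enters additively, so one truncation of \<open>h\<close> serves all base
  points.\<close>

definition trunc :: "real \<Rightarrow> circle \<Rightarrow> real \<Rightarrow> real" where
  "trunc \<mu> \<theta> x = truncation h \<mu> x + \<beta> * sin2pi \<theta>"

lemma trunc_cocycle: "monotone_cocycle \<omega> (trunc \<mu>) (1 + \<bar>\<alpha>\<bar> + \<bar>\<beta>\<bar> * (2 * pi))"
proof
  note dol = arnold_base_dol[of \<alpha> \<tau>]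
  show "\<omega> \<notin> circle_of ` \<rat>" by (rule irrational)
  show "trunc \<mu> \<theta> (x + 1) = trunc \<mu> \<theta> x + 1" for \<theta> x
    using dol_add_one[OF truncation_dol[OF dol]] by (simp add: trunc_def)
  show "trunc \<mu> \<theta> x \<le> trunc \<mu> \<theta> y" if "x \<le> y" for \<theta> x y
    using truncation_mono[OF dol that] by (simp add: trunc_def)
  fix \<theta> \<theta>' x x'
  have "\<bar>truncation h \<mu> x - truncation h \<mu> x'\<bar> \<le> (1 + \<bar>\<alpha>\<bar>) * \<bar>x - x'\<bar>"
    by (rule dol_lipschitz[OF truncation_dol[OF dol]])
  moreover have "\<bar>\<beta> * sin2pi \<theta> - \<beta> * sin2pi \<theta>'\<bar> \<le> \<bar>\<beta>\<bar> * (2 * pi * dist \<theta> \<theta>')"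
    using sin2pi_lipschitz[of \<theta> \<theta>'] by (simp add: abs_mult mult_left_mono flip: right_diff_distrib)
  moreover have "0 \<le> (1 + \<bar>\<alpha>\<bar>) * dist \<theta> \<theta>'" "0 \<le> \<bar>\<beta>\<bar> * (2 * pi) * \<bar>x - x'\<bar>" by simp_all
  ultimately have "\<bar>trunc \<mu> \<theta> x - trunc \<mu> \<theta>' x'\<bar> \<le> (1 + \<bar>\<alpha>\<bar>) * \<bar>x - x'\<bar>
      + \<bar>\<beta>\<bar> * (2 * pi * dist \<theta> \<theta>') + (1 + \<bar>\<alpha>\<bar>) * dist \<theta> \<theta>' + \<bar>\<beta>\<bar> * (2 * pi) * \<bar>x - x'\<bar>"
    unfolding trunc_def by linarith
  then show "\<bar>trunc \<mu> \<theta> x - trunc \<mu> \<theta>' x'\<bar> \<le> (1 + \<bar>\<alpha>\<bar> + \<bar>\<beta>\<bar> * (2 * pi)) * (dist \<theta> \<theta>' + \<bar>x - x'\<bar>)"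
    by (simp add: algebra_simps)
qed

definition rho :: "real \<Rightarrow> real" where
  "rho \<mu> = (SOME r. uniform_rotation \<omega> (trunc \<mu>) r)"

lemma rho: "uniform_rotation \<omega> (trunc \<mu>) (rho \<mu>)"
  unfolding rho_def by (rule someI_ex[OF monotone_cocycle.uniform_rotation_exists[OF trunc_cocycle]])

text \<open>At a fixed time \<open>m\<close> the rate for \<mu> is known up to \<open>e / 4\<close>.
  Nearby parameters change the iterates at time \<open>m\<close> only slightly, and
  \<open>uniform_rotation_close\<close> turns this into a bound on \<open>rho\<close>.\<close>

lemma continuous_rho: "continuous_on S rho"
  unfolding continuous_on_iff
proof (intro ballI allI impI)
  fix \<mu> e :: real assume "e > 0"
  then have e4: "e / 4 > 0" by simp
  then obtain N where N: "\<And>n \<theta> x. n \<ge> N \<Longrightarrow>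
      \<bar>fib_iterate \<omega> (trunc \<mu>) n \<theta> x - x - real n * rho \<mu>\<bar> \<le> e / 4 * real n"
    using rho[of \<mu>] unfolding uniform_rotation_def by metis
  define m where "m = Suc N"
  obtain B where B: "B > 0" "\<And>G d \<theta> x. (\<And>\<theta> x. \<bar>G \<theta> x - trunc \<mu> \<theta> x\<bar> \<le> d) \<Longrightarrow>
      \<bar>fib_iterate \<omega> G m \<theta> x - fib_iterate \<omega> (trunc \<mu>) m \<theta> x\<bar> \<le> d * B"
    using monotone_cocycle.iter_perturb[OF trunc_cocycle] by metis
  define d where "d = e / 4 / B"
  have "d > 0" using e4 B(1) by (simp add: d_def)
  have "\<bar>rho \<nu> - rho \<mu>\<bar> < e" if "\<bar>\<nu> - \<mu>\<bar> < d" for \<nu>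
  proof -
    have "\<bar>trunc \<nu> \<theta> x - trunc \<mu> \<theta> x\<bar> \<le> d" for \<theta> x
      using truncation_param_lipschitz[OF arnold_base_dol[of \<alpha> \<tau>], of \<nu> x \<mu>] that by (simp add: trunc_def)
    from B(2)[OF this] have p: "\<bar>fib_iterate \<omega> (trunc \<nu>) m \<theta> x - fib_iterate \<omega> (trunc \<mu>) m \<theta> x\<bar> \<le> e / 4" for \<theta> x
      using B(1) by (simp add: d_def)
    have "\<bar>fib_iterate \<omega> (trunc \<nu>) m \<theta> x - x - real m * rho \<mu>\<bar> \<le> real m * (e / 2)" for \<theta> x
    proof -
      have triangle: "\<bar>u - x - w\<bar> \<le> 2 * b" if "\<bar>u - v\<bar> \<le> a" "\<bar>v - x - w\<bar> \<le> b" "a \<le> b"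
        for u v w a b :: real using that by linarith
      have "e / 4 * 1 \<le> e / 4 * real m" using e4 by (intro mult_left_mono) (auto simp: m_def)
      moreover have "N \<le> m" by (simp add: m_def)
      ultimately have "\<bar>fib_iterate \<omega> (trunc \<nu>) m \<theta> x - x - real m * rho \<mu>\<bar> \<le> 2 * (e / 4 * real m)"
        by (intro triangle[OF p N]) simp_all
      then show ?thesis by (simp add: mult.commute)
    qed
    then have "\<bar>rho \<nu> - rho \<mu>\<bar> \<le> e / 2"
      by (intro monotone_cocycle.uniform_rotation_close[OF trunc_cocycle rho, of m]) (auto simp: m_def)
    then show ?thesis using \<open>e > 0\<close> by simp
  qed
  then show "\<exists>d>0. \<forall>\<nu>\<in>S. dist \<nu> \<mu> < d \<longrightarrow> dist (rho \<nu>) (rho \<mu>) < e"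
    using \<open>d > 0\<close> by (auto simp: dist_real_def)
qed

lemma rho_values:
  assumes "0 \<le> K" "rho 0 \<le> r" "r \<le> rho K"
  obtains \<mu> where "0 \<le> \<mu>" "rho \<mu> = r"
  using IVT'[OF assms(2,3,1) continuous_rho] by blast

text \<open>\<open>F\<close> lies between the monotone maps \<open>trunc 0\<close> and
  \<open>trunc K\<close>, and hence so do the iterates.\<close>

lemma rotation_set_bounds:
  assumes K: "\<And>y. h y \<le> lower_env h y + K" and \<rho>: "\<rho> \<in> fib_rotation_set \<omega> F"
  shows "rho 0 \<le> \<rho>" "\<rho> \<le> rho K"
proof -
  note dol = arnold_base_dol[of \<alpha> \<tau>]
  obtain \<theta> x where \<rho>: "ereal \<rho> = limsup (\<lambda>n. ereal ((fib_iterate \<omega> F n \<theta> x - x) / real n))"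
    using \<rho> unfolding fib_rotation_set_def by blast
  have lim: "limsup (\<lambda>n. ereal ((fib_iterate \<omega> (trunc \<mu>) n \<theta> x - x) / real n)) = ereal (rho \<mu>)" for \<mu>
    using uniform_rotation_tendsto[OF rho] by (intro lim_imp_Limsup) auto
  have "trunc 0 \<theta> x \<le> F \<theta> x" for \<theta> x
    using truncation_zero_le[OF dol] by (simp add: trunc_def arnold_fibre_eq)
  note ge = monotone_cocycle.iter_ge[OF trunc_cocycle this]
  have "ereal (rho 0) \<le> ereal \<rho>"
    unfolding \<rho> lim[symmetric]
    by (intro Limsup_mono always_eventually allI) (simp add: divide_right_mono ge)
  then show "rho 0 \<le> \<rho>" by simp
  have "F \<theta> x \<le> trunc K \<theta> x" for \<theta> x
    using truncation_ge_upper_env[OF dol K, of x] upper_env_ge[OF dol, of x x]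
    by (simp add: trunc_def arnold_fibre_eq)
  note le = monotone_cocycle.iter_le[OF trunc_cocycle this]
  have "ereal \<rho> \<le> ereal (rho K)"
    unfolding \<rho> lim[symmetric]
    by (intro Limsup_mono always_eventually allI) (simp add: divide_right_mono le)
  then show "\<rho> \<le> rho K" by simp
qed

section \<open>Orbits on which the truncation agrees with the base map\<close>

definition good :: "real \<Rightarrow> circle set" where
  "good \<mu> = circle_of ` {x. truncation h \<mu> x = h x}"

definition survivors :: "real \<Rightarrow> (circle \<times> circle) set" where
  "survivors \<mu> = {z. \<forall>n. snd ((f ^^ n) z) \<in> good \<mu>}"

lemma circle_of_in_good: "circle_of x \<in> good \<mu> \<longleftrightarrow> truncation h \<mu> x = h x"
proof
  note dol = arnold_base_dol[of \<alpha> \<tau>]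
  assume "circle_of x \<in> good \<mu>"
  then obtain y where y: "circle_of x = circle_of y" "truncation h \<mu> y = h y" by (auto simp: good_def)
  then obtain k where "x - y = of_int k" by (metis circle_of_eq_iff Ints_cases)
  then have x: "x = y + of_int k" by simp
  have "truncation h \<mu> x = truncation h \<mu> y + of_int k" unfolding x
    by (rule degree_one_int) (rule dol_add_one[OF truncation_dol[OF dol]])
  moreover have "h x = h y + of_int k" unfolding x
    by (rule degree_one_int) (rule dol_add_one[OF dol])
  ultimately show "truncation h \<mu> x = h x" using y(2) by simp
qed (auto simp: good_def)

lemma closed_good: "closed (good \<mu>)"
proof -
  note dol = arnold_base_dol[of \<alpha> \<tau>]
  have "closed {x. truncation h \<mu> x = h x}"
    by (intro closed_Collect_eq dol_continuous[OF dol] dol_continuous[OF truncation_dol[OF dol]])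
  moreover have "circle_of -` (- good \<mu>) = - {x. truncation h \<mu> x = h x}"
    by (auto simp: circle_of_in_good)
  ultimately show ?thesis unfolding closed_def open_circle_iff by simp
qed

lemma closed_orbit_condition: "closed {z. snd ((f ^^ n) z) \<in> good \<mu>}"
proof -
  have "continuous_on UNIV (\<lambda>z. snd ((f ^^ n) z))"
    by (intro continuous_on_snd continuous_on_funpow continuous_arnold_map)
  from closed_vimage[OF closed_good this] show ?thesis by (simp add: vimage_def)
qed

text \<open>\<open>truncation_hits\<close> supplies at each step backwards a preimage in the good
  region.\<close>

lemma backward_orbit:
  assumes "0 \<le> \<mu>"
  shows "\<exists>y. (f ^^ n) y = z \<and> (\<forall>k<n. snd ((f ^^ k) y) \<in> good \<mu>)"
proof (induction n)
  case (Suc n)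
  then obtain y1 where y1: "(f ^^ n) y1 = z" "\<And>k. k < n \<Longrightarrow> snd ((f ^^ k) y1) \<in> good \<mu>" by blast
  obtain v where v: "snd y1 = circle_of v" using circle_of_surj by blast
  obtain x where x: "truncation h \<mu> x = v - \<beta> * sin2pi (fst y1 - \<omega>)" "h x = v - \<beta> * sin2pi (fst y1 - \<omega>)"
    using truncation_hits[OF arnold_base_dol assms] by metis
  define y where "y = (fst y1 - \<omega>, circle_of x)"
  have fy: "f y = y1" using x(2) v unfolding y_def arnold_map_proj by (simp add: arnold_fibre_eq prod_eq_iff)
  have "snd ((f ^^ k) y) \<in> good \<mu>" if "k < Suc n" for k
  proof (cases k)
    case 0
    then show ?thesis using x by (simp add: y_def circle_of_in_good)
  next
    case (Suc k')
    then show ?thesis using y1(2)[of k'] that fy by (simp add: funpow_swap1)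
  qed
  moreover have "(f ^^ Suc n) y = z" using y1(1) fy by (simp add: funpow_swap1)
  ultimately show ?case by blast
qed simp

text \<open>Any finite number of the closed orbit conditions is met by the start of a long enough
  backward orbit, so compactness gives a point that meets all of them.\<close>

lemma survivors:
  assumes "0 \<le> \<mu>"
  shows "compact (survivors \<mu>)" "survivors \<mu> \<noteq> {}" "f ` survivors \<mu> \<subseteq> survivors \<mu>"
proof -
  have cU: "compact (UNIV :: (circle \<times> circle) set)"
    using compact_Times[OF compact_UNIV_circle compact_UNIV_circle] by simp
  have eq: "survivors \<mu> = (\<Inter>n. {z. snd ((f ^^ n) z) \<in> good \<mu>})" by (auto simp: survivors_def)
  have "closed (survivors \<mu>)" unfolding eq by (intro closed_INT ballI closed_orbit_condition)
  with cU show "compact (survivors \<mu>)" using compact_Int_closed by fastforce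
  have "UNIV \<inter> (\<Inter>n\<in>UNIV. {z. snd ((f ^^ n) z) \<in> good \<mu>}) \<noteq> {}"
  proof (rule compact_imp_fip_image[OF cU])
    show "closed {z. snd ((f ^^ n) z) \<in> good \<mu>}" for n by (rule closed_orbit_condition)
    fix I :: "nat set" assume "finite I" "I \<subseteq> UNIV"
    obtain y where y: "\<And>k. k < Suc (Max (insert 0 I)) \<Longrightarrow> snd ((f ^^ k) y) \<in> good \<mu>"
      using backward_orbit[OF assms] by blast
    have "n < Suc (Max (insert 0 I))" if "n \<in> I" for n
      using \<open>finite I\<close> that by (simp add: less_Suc_eq_le Max_ge)
    then have "y \<in> UNIV \<inter> (\<Inter>n\<in>I. {z. snd ((f ^^ n) z) \<in> good \<mu>})" using y by auto
    then show "UNIV \<inter> (\<Inter>n\<in>I. {z. snd ((f ^^ n) z) \<in> good \<mu>}) \<noteq> {}" by blast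
  qed
  then show "survivors \<mu> \<noteq> {}" by (simp add: eq)
  show "f ` survivors \<mu> \<subseteq> survivors \<mu>"
  proof
    fix y assume "y \<in> f ` survivors \<mu>"
    then obtain z where z: "z \<in> survivors \<mu>" "y = f z" by blast
    have "snd ((f ^^ n) y) \<in> good \<mu>" for n
    proof -
      have "snd ((f ^^ Suc n) z) \<in> good \<mu>" using z(1) unfolding survivors_def by blast
      then show ?thesis by (simp add: z(2) funpow_swap1)
    qed
    then show "y \<in> survivors \<mu>" by (simp add: survivors_def)
  qed
qed

lemma trunc_eq_fibre: "truncation h \<mu> x = h x \<Longrightarrow> trunc \<mu> \<theta> x = F \<theta> x"
  by (simp add: trunc_def arnold_fibre_eq)

lemma survivors_fibre:
  assumes "(\<theta>, circle_of x) \<in> survivors \<mu>"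
  shows "trunc \<mu> \<theta> x = F \<theta> x"
proof -
  have "snd ((f ^^ 0) (\<theta>, circle_of x)) \<in> good \<mu>" using assms unfolding survivors_def by blast
  then show ?thesis by (simp add: circle_of_in_good trunc_eq_fibre)
qed

lemma survivors_iterate:
  assumes "(\<theta>, circle_of x) \<in> survivors \<mu>"
  shows "fib_iterate \<omega> (trunc \<mu>) n \<theta> x = fib_iterate \<omega> F n \<theta> x"
proof (induction n)
  case (Suc n)
  have "snd ((f ^^ n) (\<theta>, circle_of x)) \<in> good \<mu>" using assms unfolding survivors_def by blast
  then have "truncation h \<mu> (fib_iterate \<omega> F n \<theta> x) = h (fib_iterate \<omega> F n \<theta> x)"
    by (simp add: arnold_map_funpow circle_of_in_good)
  from trunc_eq_fibre[OF this] Suc show ?case by simp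
qed simp

text \<open>Along a surviving orbit \<open>F\<close> and \<open>trunc \<mu>\<close> have the same
  iterates, so the limsup is the uniform rotation number.\<close>

lemma rho_in_rotation_set:
  assumes "0 \<le> \<mu>"
  shows "rho \<mu> \<in> fib_rotation_set \<omega> F"
proof -
  obtain z where "z \<in> survivors \<mu>" using survivors(2)[OF assms] by blast
  moreover obtain x where "snd z = circle_of x" using circle_of_surj by blast
  ultimately have z: "(fst z, circle_of x) \<in> survivors \<mu>" by (metis prod.collapse)
  have "(\<lambda>n. (fib_iterate \<omega> F n (fst z) x - x) / real n) \<longlonglongrightarrow> rho \<mu>"
    using uniform_rotation_tendsto[OF rho[of \<mu>], of "fst z" x] survivors_iterate[OF z] by simp
  then have "limsup (\<lambda>n. ereal ((fib_iterate \<omega> F n (fst z) x - x) / real n)) = ereal (rho \<mu>)"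
    by (intro lim_imp_Limsup) auto
  from this[symmetric] show ?thesis unfolding fib_rotation_set_def by blast
qed

lemma rotation_set_eq:
  assumes "0 \<le> K" "\<And>y. h y \<le> lower_env h y + K"
  shows "fib_rotation_set \<omega> F = {rho 0..rho K}"
proof (intro equalityI subsetI)
  show "\<rho> \<in> {rho 0..rho K}" if "\<rho> \<in> fib_rotation_set \<omega> F" for \<rho>
    using rotation_set_bounds[OF assms(2) that] by simp
  show "\<rho> \<in> fib_rotation_set \<omega> F" if "\<rho> \<in> {rho 0..rho K}" for \<rho>
    using rho_values[OF assms(1)] rho_in_rotation_set that by (metis atLeastAtMost_iff)
qed

text \<open>The envelope gap puts \<open>trunc 0 + 1\<close> below \<open>trunc K\<close>. As
  \<open>trunc 0\<close> commutes with integer shifts, the added one accumulates to exactly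
  \<open>n\<close> after \<open>n\<close> steps.\<close>

lemma rho_gap:
  assumes "\<bar>\<alpha>\<bar> \<ge> 5 / 2 * pi" "\<And>y. h y \<le> lower_env h y + K"
  shows "rho 0 + 1 \<le> rho K"
proof -
  note dol = arnold_base_dol[of \<alpha> \<tau>]
  define G where "G \<theta> x = trunc 0 \<theta> x + 1" for \<theta> x
  have "truncation h 0 x + 1 \<le> truncation h K x" for x
    using truncation_le[OF dol, of 0 x] truncation_ge_upper_env[OF dol assms(2), of x]
      arnold_base_env_gap[OF assms(1), of \<tau> x] by linarith
  then have "G \<theta> x \<le> trunc K \<theta> x" for \<theta> x by (simp add: G_def trunc_def)
  note le = monotone_cocycle.iter_le[OF trunc_cocycle this]
  have "trunc 0 \<theta> (x + of_int k) = trunc 0 \<theta> x + of_int k" for \<theta> x k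
    by (rule degree_one_int) (rule monotone_cocycle.add_one[OF trunc_cocycle])
  from this[where k = "int n" for n] have shift: "trunc 0 \<theta> (x + real n) = trunc 0 \<theta> x + real n" for \<theta> x n
    by simp
  have G: "fib_iterate \<omega> G n \<theta> x = fib_iterate \<omega> (trunc 0) n \<theta> x + real n" for n \<theta> x
    by (induction n) (simp_all add: G_def shift)
  show ?thesis
  proof (rule LIMSEQ_le)
    show "(\<lambda>n. (fib_iterate \<omega> (trunc 0) n 0 0 - 0) / real n + 1) \<longlonglongrightarrow> rho 0 + 1"
      by (intro tendsto_add uniform_rotation_tendsto rho tendsto_const)
    show "(\<lambda>n. (fib_iterate \<omega> (trunc K) n 0 0 - 0) / real n) \<longlonglongrightarrow> rho K"
      by (intro uniform_rotation_tendsto rho)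
    show "\<exists>N. \<forall>n\<ge>N. (fib_iterate \<omega> (trunc 0) n 0 0 - 0) / real n + 1 \<le> (fib_iterate \<omega> (trunc K) n 0 0 - 0) / real n"
    proof (intro exI[of _ 1] allI impI)
      fix n :: nat assume "n \<ge> 1"
      then have "(fib_iterate \<omega> (trunc 0) n 0 0 - 0) / real n + 1 = fib_iterate \<omega> G n 0 0 / real n"
        by (simp add: G field_simps)
      also have "\<dots> \<le> fib_iterate \<omega> (trunc K) n 0 0 / real n" by (intro divide_right_mono le) simp
      finally show "(fib_iterate \<omega> (trunc 0) n 0 0 - 0) / real n + 1 \<le> (fib_iterate \<omega> (trunc K) n 0 0 - 0) / real n"
        by simp
    qed
  qed
qed

text \<open>A connected invariant piece over the whole base would, lifted in the chart of the fibre cut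
  at \<open>a\<close>, have an image of vertical extent at least \<open>2 \<bar>\<beta>\<bar> - 1 \<ge> 2\<close>, so that this image would
  meet the cut again.\<close>

lemma no_full_connected_subset:
  assumes D: "connected D" "D \<subseteq> survivors \<mu>" "fst ` D = UNIV"
    and a: "truncation h \<mu> a \<noteq> h a" and \<beta>: "\<bar>\<beta>\<bar> \<ge> 3 / 2"
  shows False
proof -
  note dol = arnold_base_dol[of \<alpha> \<tau>]
  have ca: "circle_of a \<notin> good \<mu>" using a by (simp add: circle_of_in_good)
  have snd_good: "snd ((f ^^ n) z) \<in> good \<mu>" if "z \<in> D" for z n
    using D(2) that unfolding survivors_def by blast
  \<comment> \<open>\<open>\<Phi> z\<close> lifts the fibre coordinate of \<open>f z\<close>; it is
    continuous on \<open>D\<close> because \<open>D\<close> avoids the cut.\<close>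
  define \<Phi> where "\<Phi> z = h (cut_chart a (snd z)) + \<beta> * sin2pi (fst z)" for z
  have "continuous_on D (\<lambda>z. cut_chart a (snd z))"
  proof (rule continuous_on_compose2[OF continuous_on_cut_chart])
    show "snd ` D \<subseteq> - {circle_of a}" using snd_good[where n = 0] ca by auto
  qed (intro continuous_on_snd continuous_on_id)
  then have "continuous_on D (\<lambda>z. h (cut_chart a (snd z)))"
    by (rule continuous_on_compose2[OF dol_continuous[OF dol, of UNIV]]) simp
  moreover have "continuous_on D (\<lambda>z. sin2pi (fst z))"
    by (rule continuous_on_compose2[OF continuous_on_sin2pi[of UNIV]])
       (auto intro: continuous_on_fst continuous_on_id)
  ultimately have "continuous_on D \<Phi>"
    unfolding \<Phi>_def by (intro continuous_on_add continuous_on_mult continuous_on_const)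
  then have conn: "connected (\<Phi> ` D)" by (rule connected_continuous_image[OF _ D(1)])
  \<comment> \<open>The image \<open>f z\<close> has its fibre coordinate in the good region as
    well, which excludes \<open>circle_of a\<close>.\<close>
  have avoid: "a + of_int k \<notin> \<Phi> ` D" for k
  proof
    assume "a + of_int k \<in> \<Phi> ` D"
    then obtain z where z: "z \<in> D" "\<Phi> z = a + of_int k" by auto
    have "z = (fst z, circle_of (cut_chart a (snd z)))" by (simp add: circle_of_cut_chart)
    then have "f z = (fst z + \<omega>, circle_of (\<Phi> z))"
      using arnold_map_proj[of \<omega> \<tau> \<alpha> \<beta> "fst z" "cut_chart a (snd z)"] by (simp add: \<Phi>_def arnold_fibre_eq)
    then have "snd ((f ^^ 1) z) = circle_of a" using z(2) by (simp add: circle_of_of_int_add)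
    then show False using snd_good[OF z(1), of 1] ca by simp
  qed
  \<comment> \<open>On good points \<open>h\<close> equals the monotone truncation, so over the unit
    interval of the chart its values stay in a window of length one.\<close>
  have range: "truncation h \<mu> a \<le> h (cut_chart a (snd z))" "h (cut_chart a (snd z)) \<le> truncation h \<mu> a + 1"
    if "z \<in> D" for z
  proof -
    have "truncation h \<mu> (cut_chart a (snd z)) = h (cut_chart a (snd z))"
      using snd_good[OF that, of 0] circle_of_in_good[of "cut_chart a (snd z)" \<mu>] by (simp add: circle_of_cut_chart)
    then show "truncation h \<mu> a \<le> h (cut_chart a (snd z))" "h (cut_chart a (snd z)) \<le> truncation h \<mu> a + 1"
      using truncation_mono[OF dol cut_chart_bounds(1), of \<mu> a "snd z"]
        truncation_mono[OF dol less_imp_le[OF cut_chart_bounds(2)], of \<mu> a "snd z"]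
        dol_add_one[OF truncation_dol[OF dol], of \<mu> a] by simp_all
  qed
  obtain z1 z2 where z: "z1 \<in> D" "z2 \<in> D" "fst z1 = circle_of (1 / 4)" "fst z2 = circle_of (- (1 / 4))"
    using D(3) by (metis UNIV_I imageE)
  have "sin2pi (fst z1) = 1" "sin2pi (fst z2) = - 1" using z(3,4) by (simp_all add: sin2pi_circle_of)
  then have "\<Phi> z1 = h (cut_chart a (snd z1)) + \<beta>" "\<Phi> z2 = h (cut_chart a (snd z2)) - \<beta>"
    by (simp_all add: \<Phi>_def)
  then have gap: "\<bar>\<Phi> z1 - \<Phi> z2\<bar> \<ge> 2" using range[OF z(1)] range[OF z(2)] \<beta> by linarith
  \<comment> \<open>An interval of length one contains an integer translate of
    \<open>a\<close>.\<close>
  have far: False if "z \<in> D" "z' \<in> D" "\<Phi> z + 1 \<le> \<Phi> z'" for z z'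
  proof -
    have "{\<Phi> z..\<Phi> z'} \<subseteq> \<Phi> ` D" using conn that by (intro connected_contains_Icc) auto
    moreover have "a + of_int \<lceil>\<Phi> z - a\<rceil> \<in> {\<Phi> z..\<Phi> z'}" using that(3) by (simp, linarith)
    ultimately show False using avoid by blast
  qed
  show False using gap far[OF z(1,2)] far[OF z(2,1)] by linarith
qed

lemma strangely_dispersed_exists:
  assumes \<alpha>: "\<alpha> > 1" and \<beta>: "\<bar>\<beta>\<bar> \<ge> 3 / 2" and \<mu>: "0 \<le> \<mu>"
  shows "\<exists>M. strangely_dispersed_minimal_set f M \<and>
     uniform_limit (torus_proj -` M) (\<lambda>n (\<theta>, x). (fib_iterate \<omega> F n \<theta> x - x) / real n)
       (\<lambda>_. rho \<mu>) sequentially \<and> htop_on f M = 0"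
proof -
  note dol = arnold_base_dol[of \<alpha> \<tau>]
  obtain x y where "x < y" "h y < h x" using arnold_base_not_mono[OF \<alpha>] by metis
  \<comment> \<open>A monotone truncation cannot agree with \<open>h\<close> at both
    \<open>x\<close> and \<open>y\<close>.\<close>
  then obtain a where a: "truncation h \<mu> a \<noteq> h a"
    using truncation_mono[OF dol, of x y \<mu>] by (metis less_imp_le not_less)
  obtain M where M: "M \<subseteq> survivors \<mu>" "minimal_set f M"
    using minimal_set_exists[OF survivors[OF \<mu>]] by metis
  have cM: "compact M"
    using survivors(1)[OF \<mu>] M by (metis closed_Int_compact inf.absorb1 minimal_set_def)
  interpret minimal_rotation_extension \<omega> f M
    by unfold_locales
      (use irrational continuous_arnold_map cM M in \<open>auto simp: arnold_map_def split: prod.splits\<close>)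
  have "\<exists>\<theta>. fst ` C = {\<theta>}" if C: "C \<in> components M" for C
  proof (rule ccontr)
    assume "\<not> ?thesis"
    then obtain D where "connected D" "D \<subseteq> M" "fst ` D = UNIV"
      using component_projection[OF C] by blast
    then show False using no_full_connected_subset[of D \<mu> a] M(1) a \<beta> by blast
  qed
  then have "strangely_dispersed_minimal_set f M"
    unfolding strangely_dispersed_minimal_set_def
    using cM M(2) projection_contains_interval by blast
  moreover have "uniform_limit (torus_proj -` M) (\<lambda>n (\<theta>, x). (fib_iterate \<omega> F n \<theta> x - x) / real n)
       (\<lambda>_. rho \<mu>) sequentially"
  proof (rule uniform_limit_cong'[THEN iffD1])
    show "uniform_limit (torus_proj -` M) (\<lambda>n (\<theta>, x). (fib_iterate \<omega> (trunc \<mu>) n \<theta> x - x) / real n)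
       (\<lambda>_. rho \<mu>) sequentially"
      by (rule uniform_limit_on_subset[OF uniform_rotation_uniform_limit[OF rho]]) simp
    fix p n assume "p \<in> torus_proj -` M"
    then show "(case p of (\<theta>, x) \<Rightarrow> (fib_iterate \<omega> (trunc \<mu>) n \<theta> x - x) / real n)
        = (case p of (\<theta>, x) \<Rightarrow> (fib_iterate \<omega> F n \<theta> x - x) / real n)"
      using M(1) survivors_iterate by (auto simp: torus_proj_def split: prod.splits)
  qed simp
  \<comment> \<open>On \<open>M\<close> the map is given by the monotone cocycle
    \<open>trunc \<mu>\<close>, to which the coding argument applies.\<close>
  moreover have "htop_on f M = 0"
  proof (rule monotone_cocycle.htop_on_zero[OF trunc_cocycle])
    show "f ` M \<subseteq> M" "M \<noteq> {}" using M(2) by (auto simp: minimal_set_def)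
    show "f (\<theta>, circle_of x) = (\<theta> + \<omega>, circle_of (trunc \<mu> \<theta> x))" if "(\<theta>, circle_of x) \<in> M" for \<theta> x
      using survivors_fibre[of \<theta> x \<mu>] M(1) that by (auto simp: arnold_map_proj)
  qed
  ultimately show ?thesis by blast
qed

end

theorem theorem2p6:
  fixes \<omega> :: circle and \<tau> \<alpha> \<beta> :: real
  assumes irrational: "\<omega> \<notin> circle_of ` \<rat>"
  defines "f \<equiv> arnold_map \<omega> \<tau> \<alpha> \<beta>"
    and "F \<equiv> arnold_fibre \<tau> \<alpha> \<beta>"
  shows "(\<alpha> > 1 \<and> \<bar>\<beta>\<bar> \<ge> 3 / 2 \<longrightarrow>
           (\<forall>\<rho>\<in>fib_rotation_set \<omega> F. \<exists>M.
              strangely_dispersed_minimal_set f M \<and>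
              uniform_limit (torus_proj -` M)
                (\<lambda>n (\<theta>, x). (fib_iterate \<omega> F n \<theta> x - x) / real n) (\<lambda>_. \<rho>) sequentially \<and>
              htop_on f M = 0))
       \<and> (\<bar>\<alpha>\<bar> \<ge> 5 / 2 * pi \<longrightarrow>
           (\<exists>a b. fib_rotation_set \<omega> F = {a..b} \<and> b - a \<ge> 1) \<and>
           interior (fib_rotation_set \<omega> F) \<noteq> {})"
proof -
  interpret forced_arnold \<omega> \<tau> \<alpha> \<beta> by unfold_locales (rule irrational)
  \<comment> \<open>For this \<open>K\<close> the cap in the truncation is inactive, so
    \<open>trunc K\<close> dominates \<open>F\<close> and \<open>rho K\<close> is the upper end of
    the rotation set.\<close>
  obtain K where K: "0 \<le> K" "\<And>y. arnold_base \<tau> \<alpha> y \<le> lower_env (arnold_base \<tau> \<alpha>) y + K"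
    using truncation_bound_exists[OF arnold_base_dol] by metis
  have eq: "fib_rotation_set \<omega> F = {rho 0..rho K}"
    unfolding F_def by (rule rotation_set_eq[OF K])
  show ?thesis
  proof (intro conjI impI ballI)
    fix \<rho> assume ab: "\<alpha> > 1 \<and> \<bar>\<beta>\<bar> \<ge> 3 / 2" and "\<rho> \<in> fib_rotation_set \<omega> F"
    then obtain \<mu> where \<mu>: "0 \<le> \<mu>" "rho \<mu> = \<rho>" using rho_values[OF K(1)] by (auto simp: eq)
    show "\<exists>M. strangely_dispersed_minimal_set f M \<and>
              uniform_limit (torus_proj -` M)
                (\<lambda>n (\<theta>, x). (fib_iterate \<omega> F n \<theta> x - x) / real n) (\<lambda>_. \<rho>) sequentially \<and>
              htop_on f M = 0"
      using strangely_dispersed_exists[OF _ _ \<mu>(1)] ab unfolding \<mu>(2) f_def F_def by blast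
  next
    assume "\<bar>\<alpha>\<bar> \<ge> 5 / 2 * pi"
    then have gap: "rho 0 + 1 \<le> rho K" by (rule rho_gap[OF _ K(2)])
    then show "\<exists>a b. fib_rotation_set \<omega> F = {a..b} \<and> b - a \<ge> 1" unfolding eq by (intro exI conjI) auto
    show "interior (fib_rotation_set \<omega> F) \<noteq> {}" using gap by (simp add: eq)
  qed
qed

end
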